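(* Let $\phi(\bar y) = \exists \bar x.\, \psi(\bar x, \bar y)$ be a formula in Presburger arithmetic over $\mathbb{N}$ in which $\psi$ is quantifier-free and variadic decomposable on $\bar x$. Then there is a quantifier-free Presburger formula $\phi'(\bar y)$ that is equivalent to $\phi$ over $\mathbb{N}$ and at most singly-exponentially bigger than $\phi$; that is, there is a fixed polynomial $p$, independent of $\phi$, such that $\phi'$ can be chosen with $|\phi'| \le 2^{p(|\phi|)}$.
   Context: Quantifier-free Presburger formulas are generated by the grammar $$\psi ::= \sum_i a_i x_i \sim b \;\mid\; a x \equiv_k b y \;\mid\; x \equiv_k c \;\mid\; \psi_1 \wedge \psi_2 \;\mid\; \neg \psi,$$ where $a_i, a, b \in \mathbb{Z}$, $k, c \in \mathbb{N}$ with $0 \le c < k$, ${\sim} \in \{\le, \ge\}$, variables range over $\mathbb{N}$, and $s \equiv_k t$ means that $s - t$ is a multiple of $k$. The size $|\cdot|$ of a formula is its encoding length with integer constants written in binary. A quantifier-free Presburger formula $\psi(\bar x, \bar y)$ (with $\bar x, \bar y$ disjoint tuples of variables) is variadic decomposable on $\bar x$ if it is equivalent over $\mathbb{N}$ to a finite disjunction $\bigvee_j \Delta_j(\bar x) \wedge \psi_j(\bar y)$ for some quantifier-free Presburger formulas $\Delta_j$, $\psi_j$. *)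

theory Defs
  imports Main "HOL-Library.Log_Nat" "HOL-Computational_Algebra.Polynomial"
begin

text \<open>
  Variables are named by natural numbers.  A list of pairs \<open>(a, x)\<close> in \<open>Le\<close> and \<open>Ge\<close>
  stands for the sum of the monomials \<open>a x\<close>; the sum may be empty, so that there are
  formulas without variables.
\<close>

datatype pform =
    Le "(int \<times> nat) list" int
  | Ge "(int \<times> nat) list" int
  | CongVars nat int nat int nat  \<comment> \<open>\<open>CongVars k a x b y\<close> is \<open>a x \<equiv>\<^sub>k b y\<close>\<close>
  | CongConst nat nat nat         \<comment> \<open>\<open>CongConst k x c\<close> is \<open>x \<equiv>\<^sub>k c\<close>\<close>
  | Conj pform pform
  | Neg pform
  | Exists nat pform

text \<open>
  The modulus of either kind of congruence is positive, as the side condition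
  \<open>0 \<le> c < k\<close> of the grammar demands.
\<close>

fun quantifier_free :: "pform \<Rightarrow> bool" where
  "quantifier_free (Le ts b) \<longleftrightarrow> True"
| "quantifier_free (Ge ts b) \<longleftrightarrow> True"
| "quantifier_free (CongVars k a x b y) \<longleftrightarrow> 0 < k"
| "quantifier_free (CongConst k x c) \<longleftrightarrow> c < k"
| "quantifier_free (Conj \<phi> \<psi>) \<longleftrightarrow> quantifier_free \<phi> \<and> quantifier_free \<psi>"
| "quantifier_free (Neg \<phi>) \<longleftrightarrow> quantifier_free \<phi>"
| "quantifier_free (Exists x \<phi>) \<longleftrightarrow> False"

definition exists_tuple :: "nat list \<Rightarrow> pform \<Rightarrow> pform" where
  "exists_tuple xs \<phi> = foldr Exists xs \<phi>"

fun free_vars :: "pform \<Rightarrow> nat set" where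
  "free_vars (Le ts b) = snd ` set ts"
| "free_vars (Ge ts b) = snd ` set ts"
| "free_vars (CongVars k a x b y) = {x, y}"
| "free_vars (CongConst k x c) = {x}"
| "free_vars (Conj \<phi> \<psi>) = free_vars \<phi> \<union> free_vars \<psi>"
| "free_vars (Neg \<phi>) = free_vars \<phi>"
| "free_vars (Exists x \<phi>) = free_vars \<phi> - {x}"

definition lin_val :: "(nat \<Rightarrow> nat) \<Rightarrow> (int \<times> nat) list \<Rightarrow> int" where
  "lin_val v ts = (\<Sum>(a, x)\<leftarrow>ts. a * int (v x))"

fun sat :: "(nat \<Rightarrow> nat) \<Rightarrow> pform \<Rightarrow> bool" where
  "sat v (Le ts b) \<longleftrightarrow> lin_val v ts \<le> b"
| "sat v (Ge ts b) \<longleftrightarrow> lin_val v ts \<ge> b"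
| "sat v (CongVars k a x b y) \<longleftrightarrow> int k dvd a * int (v x) - b * int (v y)"
| "sat v (CongConst k x c) \<longleftrightarrow> int k dvd int (v x) - int c"
| "sat v (Conj \<phi> \<psi>) \<longleftrightarrow> sat v \<phi> \<and> sat v \<psi>"
| "sat v (Neg \<phi>) \<longleftrightarrow> \<not> sat v \<phi>"
| "sat v (Exists x \<phi>) \<longleftrightarrow> (\<exists>n. sat (v(x := n)) \<phi>)"

definition equivalent :: "pform \<Rightarrow> pform \<Rightarrow> bool" where
  "equivalent \<phi> \<psi> \<longleftrightarrow> (\<forall>v. sat v \<phi> \<longleftrightarrow> sat v \<psi>)"

text \<open>
  Encoding length: natural numbers and variable names are written in binary (with at least
  one digit), integers carry an additional sign, and every logical or relational symbol and
  every summand separator counts as one symbol.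
\<close>

definition nat_len :: "nat \<Rightarrow> nat" where
  "nat_len n = max 1 (floorlog 2 n)"

definition int_len :: "int \<Rightarrow> nat" where
  "int_len z = 1 + nat_len (nat \<bar>z\<bar>)"

definition lin_len :: "(int \<times> nat) list \<Rightarrow> nat" where
  "lin_len ts = (\<Sum>(a, x)\<leftarrow>ts. 1 + int_len a + nat_len x)"

fun enc_len :: "pform \<Rightarrow> nat" where
  "enc_len (Le ts b) = 1 + lin_len ts + int_len b"
| "enc_len (Ge ts b) = 1 + lin_len ts + int_len b"
| "enc_len (CongVars k a x b y) =
     1 + nat_len k + int_len a + nat_len x + int_len b + nat_len y"
| "enc_len (CongConst k x c) = 1 + nat_len k + nat_len x + nat_len c"
| "enc_len (Conj \<phi> \<psi>) = 1 + enc_len \<phi> + enc_len \<psi>"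
| "enc_len (Neg \<phi>) = 1 + enc_len \<phi>"
| "enc_len (Exists x \<phi>) = 1 + nat_len x + enc_len \<phi>"

text \<open>
  The finite disjunction is given by the list \<open>ds\<close> of its disjuncts \<open>(\<Delta>\<^sub>j, \<psi>\<^sub>j)\<close>; the
  empty disjunction is false.
\<close>

definition variadic_decomposable :: "pform \<Rightarrow> nat list \<Rightarrow> nat list \<Rightarrow> bool" where
  "variadic_decomposable \<psi> xs ys \<longleftrightarrow>
     (\<exists>ds :: (pform \<times> pform) list.
        (\<forall>(\<Delta>, \<chi>) \<in> set ds.
           quantifier_free \<Delta> \<and> free_vars \<Delta> \<subseteq> set xs \<and>
           quantifier_free \<chi> \<and> free_vars \<chi> \<subseteq> set ys) \<and>
        (\<forall>v. sat v \<psi> \<longleftrightarrow> (\<exists>(\<Delta>, \<chi>) \<in> set ds. sat v \<Delta> \<and> sat v \<chi>)))"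

end

theory Submission
  imports Defs Complex_Main "HOL-Library.FuncSet"
begin

text \<open>
  Idea: if \<open>\<psi>(x, y)\<close> holds, then \<open>\<psi>(u, y)\<close> holds for some \<open>u\<close> whose entries are bounded by
  \<open>2\<^sup>q\<close> with \<open>q\<close> polynomial in the size of \<open>\<psi>\<close>, independently of \<open>y\<close>.  Hence \<open>\<phi>'\<close> can be taken
  as the disjunction of the instances \<open>\<psi>(u, y)\<close> over all such \<open>u\<close>.

  To find \<open>u\<close>, consider the values at \<open>y\<close> of the \<open>y\<close>-parts of all linear atoms.  There is a
  threshold such that each of them is either small or much larger than the small ones.
  By the Steinitz lemma a solution of a linear system splits into a small solution and a
  homogeneous one.  Splitting \<open>(x, y)\<close> in this way yields a direction \<open>d\<close> such that \<open>\<psi>\<close> stays true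
  along the ray \<open>(x, y) + t d\<close>, the small \<open>y\<close>-parts stay constant and the large ones diverge.
  By decomposability and the pigeonhole principle, a fixed point \<open>x\<^sub>s\<close> of the ray satisfies
  \<open>\<psi>\<close> together with \<open>y\<^sub>t\<close> for arbitrarily large \<open>t\<close>.  For such \<open>t\<close> the atoms with large \<open>y\<close>-part do not depend
  on \<open>x\<^sub>s\<close> any more, so that only those with small \<open>y\<close>-part constrain the choice of
  \<open>u\<close>, and these have a small solution.
\<close>

section \<open>Small solutions of linear systems\<close>

text \<open>Gaussian elimination: a vector with nonzero entry at \<open>r\<close> serves as pivot
  and clears this coordinate in the others, which leaves one vector and one coordinate less.\<close>

lemma exists_nontrivial_kernel:
  fixes f :: "'i \<Rightarrow> 'r \<Rightarrow> real"
  assumes "finite R" "finite I" "card R < card I"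
  shows "\<exists>c. (\<exists>i\<in>I. c i \<noteq> 0) \<and> (\<forall>r\<in>R. (\<Sum>i\<in>I. c i * f i r) = 0)"
  using assms
proof (induction R arbitrary: I f rule: finite_induct)
  case empty
  then obtain i where "i \<in> I"
    by (metis card.empty card_gt_0_iff ex_in_conv)
  then show ?case by (intro exI[of _ "\<lambda>_. 1"]) auto
next
  case (insert r R)
  show ?case
  proof (cases "\<forall>i\<in>I. f i r = 0")
    case True
    from insert.IH[of I f] insert.prems insert.hyps obtain c where
      "\<exists>i\<in>I. c i \<noteq> 0" "\<forall>r\<in>R. (\<Sum>i\<in>I. c i * f i r) = 0" by auto
    with True show ?thesis by (intro exI[of _ c]) auto
  next
    case False
    then obtain j where j: "j \<in> I" "f j r \<noteq> 0" by auto
    define g where "g i q = f i q - f i r / f j r * f j q" for i q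
    have "card R < card (I - {j})"
      using insert j by (simp add: card_Diff_singleton)
    with insert.IH[of "I - {j}" g] insert.prems obtain c where
      c: "\<exists>i\<in>I - {j}. c i \<noteq> 0" "\<forall>q\<in>R. (\<Sum>i\<in>I - {j}. c i * g i q) = 0" by auto
    define s where "s = - (\<Sum>i\<in>I - {j}. c i * (f i r / f j r))"
    define c' where "c' = c(j := s)"
    have sum: "(\<Sum>i\<in>I. c' i * f i q) = (\<Sum>i\<in>I - {j}. c i * g i q)" for q
    proof -
      have "(\<Sum>i\<in>I. c' i * f i q) = s * f j q + (\<Sum>i\<in>I - {j}. c i * f i q)"
        using insert.prems j by (subst sum.remove[of _ j]) (auto simp: c'_def intro!: sum.cong)
      also have "\<dots> = (\<Sum>i\<in>I - {j}. c i * g i q)"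
        by (simp add: g_def s_def sum_distrib_right sum_distrib_left algebra_simps sum_subtractf)
      finally show ?thesis .
    qed
    have "(\<Sum>i\<in>I. c' i * f i r) = 0"
      unfolding sum using j by (simp add: g_def)
    with c sum have "\<forall>q\<in>insert r R. (\<Sum>i\<in>I. c' i * f i q) = 0" by auto
    moreover have "\<exists>i\<in>I. c' i \<noteq> 0" using c(1) by (auto simp: c'_def)
    ultimately show ?thesis by blast
  qed
qed

text \<open>The weights move to a vertex of a polytope: while more than \<open>card R\<close> of
  them are fractional, the corresponding vectors are dependent, and following a dependency until
  some weight hits 0 or 1 lowers the number of fractional weights without changing the sums.\<close>

lemma exists_few_fractional:
  fixes f :: "'i \<Rightarrow> 'r \<Rightarrow> real"
  assumes "finite R" "finite I" "\<forall>i\<in>I. l i \<in> {0..1}"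
  shows "\<exists>l'. (\<forall>i\<in>I. l' i \<in> {0..1::real}) \<and> card {i\<in>I. l' i \<noteq> 0 \<and> l' i \<noteq> 1} \<le> card R \<and>
           (\<forall>r\<in>R. (\<Sum>i\<in>I. l' i * f i r) = (\<Sum>i\<in>I. l i * f i r))"
  using assms(3)
proof (induction "card {i\<in>I. l i \<noteq> 0 \<and> l i \<noteq> 1}" arbitrary: l rule: less_induct)
  case less
  define F where "F = {i\<in>I. l i \<noteq> 0 \<and> l i \<noteq> 1}"
  have F: "finite F" "F \<subseteq> I" using assms(2) by (auto simp: F_def)
  have lF: "0 < l i" "l i < 1" if "i \<in> F" for i
    using that less.prems by (auto simp: F_def less_le)
  show ?case
  proof (cases "card F \<le> card R")
    case True
    then show ?thesis using less.prems by (intro exI[of _ l]) (auto simp: F_def)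
  next
    case False
    then obtain c where c: "\<exists>i\<in>F. c i \<noteq> 0" "\<forall>r\<in>R. (\<Sum>i\<in>F. c i * f i r) = 0"
      using exists_nontrivial_kernel[OF assms(1) F(1), of f] by auto
    define C where "C = {i\<in>F. c i \<noteq> 0}"
    have C: "finite C" "C \<noteq> {}" using F c by (auto simp: C_def)
    \<comment> \<open>\<open>\<tau> i\<close> is the step at which weight \<open>i\<close> reaches 1
      or 0, depending on the direction; the least such step keeps all weights in the unit
      interval.\<close>
    define \<tau> where "\<tau> i = (if c i > 0 then (1 - l i) / c i else - l i / c i)" for i
    obtain j where j: "j \<in> C" "\<And>i. i \<in> C \<Longrightarrow> \<tau> j \<le> \<tau> i"
      using arg_min_if_finite(1)[OF C, of \<tau>] arg_min_least[OF C, of _ \<tau>] by blast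
    have \<tau>0: "0 \<le> \<tau> i" if "i \<in> C" for i
      using that lF[of i] by (auto simp: \<tau>_def C_def divide_nonneg_neg less_imp_le)
    define l' where "l' i = (if i \<in> F then l i + \<tau> j * c i else l i)" for i
    have l': "l' i \<in> {0..1}" if "i \<in> I" for i
    proof (cases "i \<in> C")
      case True
      then have F': "i \<in> F" "c i \<noteq> 0" by (auto simp: C_def)
      have le: "\<tau> j \<le> \<tau> i" "0 \<le> \<tau> j" using j True \<tau>0 by auto
      show ?thesis
      proof (cases "c i > 0")
        case pos: True
        with le have "\<tau> j * c i \<le> 1 - l i" by (simp add: \<tau>_def field_simps)
        moreover have "0 \<le> \<tau> j * c i" using pos le by simp
        ultimately show ?thesis using F' lF[of i] by (auto simp: l'_def)
      next
        case False
        with F' have neg: "c i < 0" by auto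
        with le have "- l i \<le> \<tau> j * c i" by (simp add: \<tau>_def field_simps)
        moreover have "\<tau> j * c i \<le> 0" using neg le by (simp add: mult_nonneg_nonpos)
        ultimately show ?thesis using F' lF[of i] by (auto simp: l'_def)
      qed
    next
      case False
      then show ?thesis using less.prems that by (auto simp: l'_def C_def)
    qed
    have jF: "j \<in> F" "c j \<noteq> 0" using j by (auto simp: C_def)
    have "l' j = 0 \<or> l' j = 1" using jF by (auto simp: l'_def \<tau>_def)
    moreover have "i \<in> F" if "i \<in> I" "l' i \<noteq> 0 \<and> l' i \<noteq> 1" for i
      using that by (auto simp: l'_def F_def split: if_splits)
    ultimately have "{i\<in>I. l' i \<noteq> 0 \<and> l' i \<noteq> 1} \<subseteq> F - {j}" by blast
    then have "card {i\<in>I. l' i \<noteq> 0 \<and> l' i \<noteq> 1} < card F"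
      using F jF by (metis card_Diff1_less card_mono finite_Diff le_less_trans)
    with less.hyps[of l'] l' obtain l'' where l'':
      "\<forall>i\<in>I. l'' i \<in> {0..1}" "card {i\<in>I. l'' i \<noteq> 0 \<and> l'' i \<noteq> 1} \<le> card R"
      "\<forall>r\<in>R. (\<Sum>i\<in>I. l'' i * f i r) = (\<Sum>i\<in>I. l' i * f i r)"
      unfolding F_def by blast
    have "(\<Sum>i\<in>I. l' i * f i r) = (\<Sum>i\<in>I. l i * f i r)" if "r \<in> R" for r
    proof -
      have "(\<Sum>i\<in>I. l' i * f i r)
          = (\<Sum>i\<in>I. l i * f i r + (if i \<in> F then \<tau> j * (c i * f i r) else 0))"
        by (intro sum.cong) (auto simp: l'_def algebra_simps)
      also have "\<dots> = (\<Sum>i\<in>I. l i * f i r) + \<tau> j * (\<Sum>i\<in>F. c i * f i r)"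
        using assms(2) F by (simp add: sum.distrib sum.If_cases Int_absorb1 sum_distrib_left)
      finally show ?thesis using c that by simp
    qed
    with l'' show ?thesis by (intro exI[of _ l''] conjI ballI) simp_all
  qed
qed

text \<open>Induction step of the Steinitz lemma: once the total weight is lowered by one, rounding
  forces some weight to be 0, and its index can be split off.\<close>

lemma remove_one_weight:
  fixes f :: "'i \<Rightarrow> 'r \<Rightarrow> real"
  assumes "finite R" "finite I" "\<forall>i\<in>I. l i \<in> {0..1}"
    and "card R < card I" "(\<Sum>i\<in>I. l i) = real (card I) - real (card R)"
  shows "\<exists>j\<in>I. \<exists>l' \<rho>. \<rho> \<in> {0..1} \<and> (\<forall>i\<in>I - {j}. l' i \<in> {0..1::real}) \<and>
           (\<Sum>i\<in>I - {j}. l' i) = real (card (I - {j})) - real (card R) \<and>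
           (\<forall>r\<in>R. (\<Sum>i\<in>I - {j}. l' i * f i r) = \<rho> * (\<Sum>i\<in>I. l i * f i r))"
proof -
  define n where "n = real (card I) - real (card R)"
  have n: "n \<ge> 1" using assms(4) by (simp add: n_def)
  \<comment> \<open>\<open>n\<close> is the total weight, and \<open>\<rho>\<close> scales it to
    \<open>n - 1\<close>.\<close>
  define \<rho> where "\<rho> = (n - 1) / n"
  have \<rho>: "\<rho> \<in> {0..1}" using n by (simp add: \<rho>_def)
  \<comment> \<open>The extra coordinate \<open>None\<close> is constantly 1, so that rounding
    preserves the total weight as well, at the price of one more fractional weight.\<close>
  define g where "g i = case_option 1 (f i)" for i
  have "\<forall>i\<in>I. \<rho> * l i \<in> {0..1}"
    using assms(3) \<rho> by (auto intro: mult_le_one)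
  from exists_few_fractional[of "insert None (Some ` R)" I "\<lambda>i. \<rho> * l i" g, OF _ assms(2) this] assms(1)
  obtain k where k: "\<forall>i\<in>I. k i \<in> {0..1}"
      "card {i\<in>I. k i \<noteq> 0 \<and> k i \<noteq> 1} \<le> card (insert None (Some ` R))"
      "\<forall>r\<in>insert None (Some ` R). (\<Sum>i\<in>I. k i * g i r) = (\<Sum>i\<in>I. \<rho> * l i * g i r)"
    by auto
  have cardR: "card (insert None (Some ` R)) = card R + 1"
    using assms(1) by (simp add: card_image)
  have "(\<Sum>i\<in>I. k i * g i None) = (\<Sum>i\<in>I. \<rho> * l i * g i None)" using k(3) by blast
  then have sumk: "(\<Sum>i\<in>I. k i) = n - 1"
  proof -
    assume "(\<Sum>i\<in>I. k i * g i None) = (\<Sum>i\<in>I. \<rho> * l i * g i None)"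
    then have "(\<Sum>i\<in>I. k i) = \<rho> * (\<Sum>i\<in>I. l i)" by (simp add: g_def sum_distrib_left)
    also have "\<dots> = \<rho> * n" using assms(5) by (simp add: n_def)
    finally show ?thesis using n by (simp add: \<rho>_def)
  qed
  have sumr: "(\<Sum>i\<in>I. k i * f i r) = \<rho> * (\<Sum>i\<in>I. l i * f i r)" if "r \<in> R" for r
  proof -
    have "(\<Sum>i\<in>I. k i * g i (Some r)) = (\<Sum>i\<in>I. \<rho> * l i * g i (Some r))" using k(3) that by blast
    then show ?thesis by (simp add: g_def sum_distrib_left mult.assoc)
  qed
  \<comment> \<open>Without zeros, every weight that is not fractional is 1. As at most
    \<open>card R + 1\<close> weights are fractional, and these are positive, the total would exceed
    \<open>n - 1 = card I - card R - 1\<close>.\<close>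
  have "\<exists>j\<in>I. k j = 0"
  proof (rule ccontr)
    assume no: "\<not> ?thesis"
    define F where "F = {i\<in>I. k i \<noteq> 0 \<and> k i \<noteq> 1}"
    have F: "finite F" "F \<subseteq> I" "card F \<le> card R + 1"
      using assms(2) k(2) cardR by (auto simp: F_def)
    have "(\<Sum>i\<in>I. k i) = (\<Sum>i\<in>I - F. k i) + (\<Sum>i\<in>F. k i)"
      using assms(2) F by (metis sum.subset_diff)
    also have "(\<Sum>i\<in>I - F. k i) = (\<Sum>i\<in>I - F. 1)"
      using no by (intro sum.cong) (auto simp: F_def)
    also have "\<dots> = real (card I) - real (card F)"
      using assms(2) F by (simp add: card_Diff_subset of_nat_diff card_mono)
    finally have eq: "n - 1 = real (card I) - real (card F) + (\<Sum>i\<in>F. k i)" using sumk by simp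
    show False
    proof (cases "F = {}")
      case True
      then show False using eq by (simp add: n_def)
    next
      case False
      have "\<forall>i\<in>F. 0 < k i" using no k(1) F by (fastforce simp: F_def less_le)
      then have "0 < (\<Sum>i\<in>F. k i)" using False F by (intro sum_pos) auto
      then show False using eq F(3) by (simp add: n_def)
    qed
  qed
  then obtain j where j: "j \<in> I" "k j = 0" by auto
  have drop: "(\<Sum>i\<in>I - {j}. k i * h i) = (\<Sum>i\<in>I. k i * h i)" for h
    using assms(2) j by (simp add: sum.remove[of I j])
  have "(\<Sum>i\<in>I - {j}. k i) = n - 1" using drop[of "\<lambda>_. 1"] sumk by simp
  also have "\<dots> = real (card (I - {j})) - real (card R)"
    using j assms(2,4) by (simp add: n_def card_Diff_singleton of_nat_diff Suc_leI)
  finally show ?thesis using j(1) k(1) \<rho> drop sumr by (intro bexI[of _ j] exI[of _ k] exI[of _ \<rho>] conjI ballI) simp_all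
qed

text \<open>The Steinitz lemma, with the proof of Grinberg and Sevastyanov.\<close>

lemma steinitz_weighted:
  fixes f :: "'i \<Rightarrow> 'r \<Rightarrow> real"
  assumes "finite R" "finite I" "\<forall>i\<in>I. l i \<in> {0..1}"
    and "(\<Sum>i\<in>I. l i) = real (card I) - real (card R)"
    and "\<forall>i\<in>I. \<forall>r\<in>R. \<bar>f i r\<bar> \<le> D" "0 \<le> D"
  shows "\<exists>xs. distinct xs \<and> set xs = I \<and> (\<forall>k. \<exists>\<theta>\<in>{0..1}. \<forall>r\<in>R.
           \<bar>(\<Sum>i\<in>set (take k xs). f i r) - \<theta> * (\<Sum>i\<in>I. l i * f i r)\<bar> \<le> real (card R) * D)"
  using assms(2-5)
proof (induction "card I" arbitrary: I l rule: less_induct)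
  case less
  show ?case
  proof (cases "card I \<le> card R")
    case True
    \<comment> \<open>So few vectors stay within the bound in any order, with
      \<open>\<theta> = 0\<close>.\<close>
    obtain xs where xs: "distinct xs" "set xs = I"
      using finite_distinct_list less.prems(1) by blast
    have "\<bar>\<Sum>i\<in>set (take k xs). f i r\<bar> \<le> real (card R) * D" if "r \<in> R" for k r
    proof -
      have sub: "set (take k xs) \<subseteq> I" using xs(2) set_take_subset[of k xs] by simp
      have "\<bar>\<Sum>i\<in>set (take k xs). f i r\<bar> \<le> (\<Sum>i\<in>set (take k xs). D)"
        by (rule order_trans[OF sum_abs sum_mono]) (use sub less.prems(4) that in blast)
      also have "\<dots> \<le> real (card R) * D"
        using True card_mono[OF less.prems(1) sub] assms(6) by (simp add: mult_right_mono)
      finally show ?thesis .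
    qed
    then show ?thesis using xs by (intro exI[of _ xs]) (auto intro!: bexI[of _ 0])
  next
    case False
    then have "card R < card I" by simp
    from remove_one_weight[OF assms(1) less.prems(1,2) this less.prems(3), of f]
    obtain j l' \<rho> where j: "j \<in> I" and \<rho>: "\<rho> \<in> {0..1}"
      and l': "\<forall>i\<in>I - {j}. l' i \<in> {0..1}" "(\<Sum>i\<in>I - {j}. l' i) = real (card (I - {j})) - real (card R)"
      and sum: "\<forall>r\<in>R. (\<Sum>i\<in>I - {j}. l' i * f i r) = \<rho> * (\<Sum>i\<in>I. l i * f i r)"
      by blast
    have "card (I - {j}) < card I" using j less.prems(1) by (meson card_Diff1_less)
    from less.hyps[OF this _ l'] less.prems obtain xs where xs: "distinct xs" "set xs = I - {j}"
      and part: "\<And>k. \<exists>\<theta>\<in>{0..1}. \<forall>r\<in>R. \<bar>(\<Sum>i\<in>set (take k xs). f i r)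
         - \<theta> * (\<Sum>i\<in>I - {j}. l' i * f i r)\<bar> \<le> real (card R) * D" by auto
    \<comment> \<open>The split-off index comes last. Proper prefixes are covered by induction,
      where the weighted sum is \<open>\<rho>\<close> times the present one. The full sum differs
      from the weighted one by the weights \<open>1 - l i\<close>, whose total is
      \<open>card R\<close>.\<close>
    have "\<exists>\<theta>\<in>{0..1}. \<forall>r\<in>R. \<bar>(\<Sum>i\<in>set (take k (xs @ [j])). f i r)
        - \<theta> * (\<Sum>i\<in>I. l i * f i r)\<bar> \<le> real (card R) * D" for k
    proof (cases "k \<le> length xs")
      case True
      obtain \<theta> where \<theta>: "\<theta> \<in> {0..1}" "\<forall>r\<in>R. \<bar>(\<Sum>i\<in>set (take k xs). f i r)
         - \<theta> * (\<Sum>i\<in>I - {j}. l' i * f i r)\<bar> \<le> real (card R) * D" using part[of k] by blast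
      then show ?thesis using True \<rho> sum
        by (intro bexI[of _ "\<theta> * \<rho>"]) (auto simp: mult.assoc intro: mult_le_one)
    next
      case False
      then have set: "set (take k (xs @ [j])) = I" using xs j by auto
      have "\<bar>(\<Sum>i\<in>I. f i r) - 1 * (\<Sum>i\<in>I. l i * f i r)\<bar> \<le> real (card R) * D" if "r \<in> R" for r
      proof -
        have "\<bar>(\<Sum>i\<in>I. f i r) - 1 * (\<Sum>i\<in>I. l i * f i r)\<bar> = \<bar>\<Sum>i\<in>I. (1 - l i) * f i r\<bar>"
          by (simp add: algebra_simps sum_subtractf)
        also have "\<dots> \<le> (\<Sum>i\<in>I. (1 - l i) * D)"
          using less.prems(2,4) that
          by (intro order_trans[OF sum_abs] sum_mono) (auto simp: abs_mult intro!: mult_left_mono)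
        also have "\<dots> = (real (card I) - (\<Sum>i\<in>I. l i)) * D"
          by (simp add: sum_subtractf flip: sum_distrib_right)
        finally show ?thesis using less.prems(3) by simp
      qed
      then show ?thesis unfolding set by (intro bexI[of _ 1]) auto
    qed
    moreover have "distinct (xs @ [j])" "set (xs @ [j]) = I" using xs j by auto
    ultimately show ?thesis by blast
  qed
qed

section \<open>Zero-sum subfamilies and small solutions of equations\<close>

text \<open>In the Steinitz order, the partial sums stay near the segment from 0 to
  \<open>w\<close>. Few lattice points lie there, so two prefixes have the same sum, and their
  difference sums to 0. As a segment is one-dimensional, the count is linear in
  \<open>\<beta>\<close>.\<close>

lemma exists_zero_sum_subset:
  fixes f :: "'i \<Rightarrow> 'r \<Rightarrow> int" and D \<beta> :: nat
  assumes "finite R" "finite I"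
    and D: "\<forall>i\<in>I. \<forall>r\<in>R. \<bar>f i r\<bar> \<le> int D"
    and \<beta>: "\<forall>r\<in>R. \<bar>\<Sum>i\<in>I. f i r\<bar> \<le> int \<beta>"
    and large: "(\<beta> + 2) * (2 * card R * D + 5) ^ card R \<le> card I"
  shows "\<exists>B\<subseteq>I. B \<noteq> {} \<and> (\<forall>r\<in>R. (\<Sum>i\<in>B. f i r) = 0)"
proof -
  define m where "m = card R"
  define n where "n = card I"
  have "m < 2 ^ m" by (rule less_exp)
  also have "\<dots> \<le> (2 * m * D + 5) ^ m" by (rule power_mono) auto
  also have "\<dots> \<le> (\<beta> + 2) * (2 * m * D + 5) ^ m" by simp
  finally have mn: "m < n" using large by (simp add: m_def n_def)
  \<comment> \<open>Uniform weights of total \<open>n - m\<close>, as the Steinitz lemma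
    demands.\<close>
  define w where "w r = (\<Sum>i\<in>I. (real n - real m) / real n * real_of_int (f i r))" for r
  have w_bound: "\<bar>w r\<bar> \<le> real \<beta>" if "r \<in> R" for r
  proof -
    have "w r = (real n - real m) / real n * real_of_int (\<Sum>i\<in>I. f i r)"
      by (simp add: w_def sum_distrib_left)
    then have "\<bar>w r\<bar> = (real n - real m) / real n * real_of_int \<bar>\<Sum>i\<in>I. f i r\<bar>"
      using mn by (simp add: abs_mult)
    also have "\<dots> \<le> 1 * real_of_int \<bar>\<Sum>i\<in>I. f i r\<bar>"
      using mn by (intro mult_right_mono) auto
    also have "\<dots> \<le> real \<beta>" using \<beta> that by (metis mult_1 of_int_le_iff of_int_of_nat_eq)
    finally show ?thesis .
  qed
  have "\<exists>xs. distinct xs \<and> set xs = I \<and> (\<forall>k. \<exists>\<theta>\<in>{0..1}. \<forall>r\<in>R.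
      \<bar>(\<Sum>i\<in>set (take k xs). real_of_int (f i r)) - \<theta> * w r\<bar> \<le> real (card R) * real D)"
    unfolding w_def
  proof (rule steinitz_weighted[OF assms(1,2)])
    show "\<forall>i\<in>I. (real n - real m) / real n \<in> {0..1}" using mn by auto
    show "(\<Sum>i\<in>I. (real n - real m) / real n) = real (card I) - real (card R)"
      using mn by (simp add: n_def m_def)
    show "\<forall>i\<in>I. \<forall>r\<in>R. \<bar>real_of_int (f i r)\<bar> \<le> real D"
      using D by (metis of_int_abs of_int_le_iff of_int_of_nat_eq)
  qed simp
  then obtain xs where xs: "distinct xs" "set xs = I" and "\<forall>k. \<exists>\<theta>\<in>{0..1}. \<forall>r\<in>R.
      \<bar>(\<Sum>i\<in>set (take k xs). real_of_int (f i r)) - \<theta> * w r\<bar> \<le> real m * real D"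
    unfolding m_def by blast
  then obtain \<theta> where \<theta>: "\<And>k. \<theta> k \<in> {0..1}" and close: "\<And>k r. r \<in> R \<Longrightarrow>
      \<bar>(\<Sum>i\<in>set (take k xs). real_of_int (f i r)) - \<theta> k * w r\<bar> \<le> real m * real D"
    by metis
  define S where "S k r = (\<Sum>i\<in>set (take k xs). f i r)" for k r
  \<comment> \<open>A prefix is encoded by a rounded position on the segment, in steps of
    \<open>1 / (\<beta> + 1)\<close>, and by the offset of its sum from the rounded point there. As
    \<open>w\<close> is bounded by \<open>\<beta>\<close>, one step moves each coordinate by at most
    1.\<close>
  define q where "q k = \<lfloor>\<theta> k * (real \<beta> + 1)\<rfloor>" for k
  define T where "T q r = \<lfloor>real_of_int q / (real \<beta> + 1) * w r\<rfloor>" for q r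
  define code where "code k = (q k, \<lambda>r\<in>R. S k r - T (q k) r)" for k
  \<comment> \<open>The Steinitz bound contributes \<open>m * D\<close>; the rounding of the
    position and that of the point contribute 1 each.\<close>
  define d where "d = int (m * D + 2)"
  have code: "code k \<in> {0..int \<beta> + 1} \<times> (R \<rightarrow>\<^sub>E {-d..d})" for k
  proof -
    have "q k \<in> {0..int \<beta> + 1}"
    proof -
      have "0 \<le> \<theta> k * (real \<beta> + 1)" using \<theta>[of k] by simp
      moreover have "\<theta> k * (real \<beta> + 1) \<le> 1 * (real \<beta> + 1)"
        using \<theta>[of k] by (intro mult_right_mono) auto
      moreover have "\<lfloor>y\<rfloor> \<in> {0..int \<beta> + 1}" if "0 \<le> y" "y \<le> 1 * (real \<beta> + 1)" for y :: real
        using that by (simp add: floor_le_iff)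
      ultimately show ?thesis unfolding q_def by blast
    qed
    moreover have "S k r - T (q k) r \<in> {-d..d}" if "r \<in> R" for r
    proof -
      define x where "x = real_of_int (q k) / (real \<beta> + 1)"
      have "\<bar>\<theta> k * (real \<beta> + 1) - q k\<bar> \<le> 1" unfolding q_def by linarith
      then have "\<bar>(\<theta> k - x) * (real \<beta> + 1)\<bar> \<le> 1" by (simp add: x_def left_diff_distrib)
      then have x: "\<bar>\<theta> k - x\<bar> * (real \<beta> + 1) \<le> 1" by (simp add: abs_mult)
      have "\<bar>(\<theta> k - x) * w r\<bar> \<le> \<bar>\<theta> k - x\<bar> * (real \<beta> + 1)"
        unfolding abs_mult using w_bound[OF that] by (intro mult_left_mono) auto
      then have 1: "\<bar>(\<theta> k - x) * w r\<bar> \<le> 1" using x by linarith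
      have 2: "\<bar>x * w r - T (q k) r\<bar> \<le> 1" unfolding T_def x_def by linarith
      have 3: "\<bar>S k r - \<theta> k * w r\<bar> \<le> real m * real D" using close[OF that, of k] by (simp add: S_def)
      have "real_of_int (S k r - T (q k) r)
          = (S k r - \<theta> k * w r) + (\<theta> k - x) * w r + (x * w r - T (q k) r)"
        by (simp add: algebra_simps)
      then have "\<bar>real_of_int (S k r - T (q k) r)\<bar> \<le> real m * real D + 2"
        using 1 2 3 by linarith
      also have "\<dots> = real_of_int d" by (simp add: d_def)
      finally have "\<bar>S k r - T (q k) r\<bar> \<le> d" by linarith
      then show ?thesis by auto
    qed
    ultimately show ?thesis by (auto simp: code_def)
  qed
  have "card ({0..int \<beta> + 1} \<times> (R \<rightarrow>\<^sub>E {-d..d})) = (\<beta> + 2) * (2 * m * D + 5) ^ m"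
  proof -
    have "card {-d..d} = 2 * m * D + 5" by (simp add: d_def nat_eq_iff)
    moreover have "card {0..int \<beta> + 1} = \<beta> + 2" by simp
    ultimately show ?thesis using assms(1)
      by (simp only: card_cartesian_product card_funcsetE m_def)
  qed
  \<comment> \<open>The \<open>n + 1\<close> prefixes, the empty one included, outnumber the
    codes.\<close>
  then have "card ({0..int \<beta> + 1} \<times> (R \<rightarrow>\<^sub>E {-d..d})) < card {..n}"
    using large by (simp add: m_def n_def)
  moreover have "code ` {..n} \<subseteq> {0..int \<beta> + 1} \<times> (R \<rightarrow>\<^sub>E {-d..d})" using code by blast
  moreover have "finite ({0..int \<beta> + 1} \<times> (R \<rightarrow>\<^sub>E {-d..d}))"
    using assms(1) by (intro finite_cartesian_product finite_PiE) auto
  ultimately have "\<not> inj_on code {..n}"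
    by (metis card_image card_mono not_less)
  then obtain j k where jk: "j < k" "k \<le> n" "code j = code k"
    unfolding inj_on_def by (metis atMost_iff nat_neq_iff)
  define B where "B = set (take k xs) - set (take j xs)"
  have sub: "set (take j xs) \<subseteq> set (take k xs)"
    using jk(1) by (simp add: set_take_subset_set_take)
  have "card (set (take j xs)) < card (set (take k xs))"
    using xs jk n_def distinct_card[OF xs(1)] by (simp add: distinct_card)
  then have "B \<noteq> {}" using sub unfolding B_def by auto
  moreover have "(\<Sum>i\<in>B. f i r) = 0" if "r \<in> R" for r
  proof -
    have "S j r - T (q j) r = S k r - T (q k) r" "q j = q k"
      using jk(3) that unfolding code_def by (auto dest: fun_cong[of _ _ r])
    then have "S j r = S k r" by simp
    then show ?thesis using sub by (simp add: B_def S_def sum_diff)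
  qed
  moreover have "B \<subseteq> I" using xs(2) set_take_subset[of k xs] by (auto simp: B_def)
  ultimately show ?thesis by blast
qed

text \<open>
  The bound is linear in \<open>\<beta>\<close>: the choice of the threshold in \<open>exists_small_witness\<close> iterates it linearly often, so that any
  higher power would give a doubly exponential bound.
\<close>

lemma exists_small_solution:
  fixes a :: "'r \<Rightarrow> 'c \<Rightarrow> int" and z :: "'c \<Rightarrow> nat" and D \<beta> :: nat
  assumes "finite R" "finite J"
    and D: "\<forall>r\<in>R. \<forall>j\<in>J. \<bar>a r j\<bar> \<le> int D"
    and "\<forall>r\<in>R. \<bar>\<Sum>j\<in>J. a r j * int (z j)\<bar> \<le> int \<beta>"
  shows "\<exists>p. (\<forall>j. p j \<le> z j) \<and>
           (\<forall>r\<in>R. (\<Sum>j\<in>J. a r j * int (p j)) = (\<Sum>j\<in>J. a r j * int (z j))) \<and>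
           (\<Sum>j\<in>J. p j) \<le> (\<beta> + 2) * (2 * card R * D + 5) ^ card R"
  using assms(4)
proof (induction "\<Sum>j\<in>J. z j" arbitrary: z rule: less_induct)
  case less
  show ?case
  proof (cases "(\<Sum>j\<in>J. z j) \<le> (\<beta> + 2) * (2 * card R * D + 5) ^ card R")
    case True
    then show ?thesis by (intro exI[of _ z]) auto
  next
    case False
    \<comment> \<open>The vector \<open>z\<close> is read as a family with \<open>z j\<close> copies
      of column \<open>j\<close>; a zero-sum subfamily can be removed without changing any
      row.\<close>
    define I where "I = Sigma J (\<lambda>j. {..<z j})"
    have I: "finite I" "card I = (\<Sum>j\<in>J. z j)" using assms(2) by (auto simp: I_def)
    have sumI: "(\<Sum>i\<in>I. a r (fst i)) = (\<Sum>j\<in>J. a r j * int (z j))" for r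
    proof -
      have "(\<Sum>i\<in>I. a r (fst i)) = (\<Sum>j\<in>J. \<Sum>c<z j. a r j)"
        unfolding I_def using assms(2) by (subst sum.Sigma) (auto simp: case_prod_beta')
      then show ?thesis by (simp add: mult.commute)
    qed
    obtain B where B: "B \<subseteq> I" "B \<noteq> {}" "\<forall>r\<in>R. (\<Sum>i\<in>B. a r (fst i)) = 0"
      using exists_zero_sum_subset[of R I "\<lambda>i r. a r (fst i)" D \<beta>] assms(1) D less.prems I sumI False
      by (auto simp: I_def)
    define u where "u j = card {c. (j, c) \<in> B}" for j
    have finB: "finite {c. (j, c) \<in> B}" for j
      using finite_subset[OF B(1) I(1)] by (rule finite_surj[of _ _ snd]) force
    have u_le: "u j \<le> z j" for j
    proof -
      have "{c. (j, c) \<in> B} \<subseteq> {..<z j}" using B(1) by (auto simp: I_def)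
      then show ?thesis unfolding u_def using card_mono[of "{..<z j}"] by fastforce
    qed
    have B_eq: "B = Sigma J (\<lambda>j. {c. (j, c) \<in> B})" using B(1) by (auto simp: I_def)
    have sumB: "(\<Sum>i\<in>B. g (fst i)) = (\<Sum>j\<in>J. g j * int (u j))" for g
    proof -
      have "(\<Sum>i\<in>B. g (fst i)) = (\<Sum>i\<in>Sigma J (\<lambda>j. {c. (j, c) \<in> B}). g (fst i))" using B_eq by simp
      also have "\<dots> = (\<Sum>j\<in>J. \<Sum>c\<in>{c. (j, c) \<in> B}. g j)"
        using assms(2) finB by (subst sum.Sigma) (auto simp: case_prod_beta')
      also have "\<dots> = (\<Sum>j\<in>J. g j * int (u j))"
        by (simp add: u_def mult.commute)
      finally show ?thesis .
    qed
    define z' where "z' j = z j - u j" for j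
    have z': "int (z' j) = int (z j) - int (u j)" for j using u_le[of j] by (simp add: z'_def of_nat_diff)
    have eq: "(\<Sum>j\<in>J. a r j * int (z' j)) = (\<Sum>j\<in>J. a r j * int (z j))" if "r \<in> R" for r
      using B(3) that sumB[of "a r"] by (simp add: z' right_diff_distrib sum_subtractf)
    have "(\<Sum>j\<in>J. int (u j)) = int (card B)" using sumB[of "\<lambda>_. 1"] by simp
    moreover have "0 < card B" using B(2) finite_subset[OF B(1) I(1)] by (simp add: card_gt_0_iff)
    moreover have "int (\<Sum>j\<in>J. z' j) = int (\<Sum>j\<in>J. z j) - (\<Sum>j\<in>J. int (u j))"
      by (simp add: z' sum_subtractf)
    ultimately have "(\<Sum>j\<in>J. z' j) < (\<Sum>j\<in>J. z j)" by linarith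
    from less.hyps[OF this] less.prems eq obtain p where p: "\<forall>j. p j \<le> z' j"
      "\<forall>r\<in>R. (\<Sum>j\<in>J. a r j * int (p j)) = (\<Sum>j\<in>J. a r j * int (z' j))"
      "(\<Sum>j\<in>J. p j) \<le> (\<beta> + 2) * (2 * card R * D + 5) ^ card R" by auto
    have "\<forall>j. p j \<le> z j" using p(1) unfolding z'_def by (meson diff_le_self order_trans)
    with p eq show ?thesis by (intro exI[of _ p]) simp
  qed
qed

section \<open>Linear forms and small solutions with the same signs\<close>

definition lin_norm :: "(int \<times> nat) list \<Rightarrow> int" where
  "lin_norm ts = (\<Sum>(a, x)\<leftarrow>ts. \<bar>a\<bar>)"

definition lin_coeff :: "(int \<times> nat) list \<Rightarrow> nat \<Rightarrow> int" where
  "lin_coeff ts x = (\<Sum>(a, y)\<leftarrow>ts. if y = x then a else 0)"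

lemma lin_val_conv_coeff:
  assumes "finite V" "snd ` set ts \<subseteq> V"
  shows "lin_val v ts = (\<Sum>x\<in>V. lin_coeff ts x * int (v x))"
  using assms(2)
proof (induction ts)
  case (Cons t ts)
  obtain a y where t: "t = (a, y)" by (cases t)
  have "(\<Sum>x\<in>V. lin_coeff (t # ts) x * int (v x))
      = (\<Sum>x\<in>V. (if x = y then a * int (v x) else 0) + lin_coeff ts x * int (v x))"
    by (intro sum.cong) (auto simp: t lin_coeff_def algebra_simps)
  also have "\<dots> = a * int (v y) + (\<Sum>x\<in>V. lin_coeff ts x * int (v x))"
    using assms(1) Cons.prems by (simp add: sum.distrib t)
  finally show ?case using Cons by (simp add: t lin_val_def)
qed (simp add: lin_val_def lin_coeff_def)

lemma abs_lin_coeff_le: "\<bar>lin_coeff ts x\<bar> \<le> lin_norm ts"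
proof (induction ts)
  case (Cons t ts)
  then show ?case by (cases t) (auto simp: lin_coeff_def lin_norm_def)
qed (simp add: lin_coeff_def lin_norm_def)

lemma abs_lin_val_le:
  assumes "\<forall>x \<in> snd ` set ts. v x \<le> B"
  shows "\<bar>lin_val v ts\<bar> \<le> lin_norm ts * int B"
  using assms
proof (induction ts)
  case (Cons t ts)
  obtain a y where t: "t = (a, y)" by (cases t)
  have "\<bar>a * int (v y)\<bar> \<le> \<bar>a\<bar> * int B"
    unfolding abs_mult using Cons.prems by (intro mult_left_mono) (auto simp: t)
  moreover have "\<bar>lin_val v ts\<bar> \<le> lin_norm ts * int B" using Cons by auto
  ultimately show ?case by (auto simp: t lin_val_def lin_norm_def distrib_right)
qed (simp add: lin_val_def lin_norm_def)

lemma lin_norm_nonneg: "0 \<le> lin_norm ts"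
  using abs_lin_coeff_le[of ts 0] by linarith

text \<open>
  A slack variable per row, counting the distance of the row from its sign condition, turns
  the preservation of signs into a system of equations.
\<close>

lemma exists_small_same_signs:
  fixes L :: "((int \<times> nat) list \<times> int) set" and z :: "nat \<Rightarrow> nat" and m D \<beta> :: nat
  assumes "finite L" "card L \<le> m" "1 \<le> D"
    and L: "\<And>ts c. (ts, c) \<in> L \<Longrightarrow> lin_norm ts \<le> int D \<and> \<bar>c\<bar> \<le> int \<beta>"
  shows "\<exists>p. (\<forall>x. p x \<le> z x \<and> p x \<le> (\<beta> + 3) * (2 * m * D + 5) ^ m) \<and>
           (\<forall>(ts, c) \<in> L. sgn (lin_val p ts - c) = sgn (lin_val z ts - c) \<and>
              (\<exists>k::nat. lin_val z ts - lin_val p ts = int k * sgn (lin_val z ts - c)))"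
proof -
  define V where "V = (\<Union>(ts, c)\<in>L. snd ` set ts)"
  have V: "finite V" "\<And>ts c. (ts, c) \<in> L \<Longrightarrow> snd ` set ts \<subseteq> V"
    using assms(1) by (force simp: V_def)+
  define e where "e l = (case l of (ts, c) \<Rightarrow> sgn (lin_val z ts - c))" for l :: "(int \<times> nat) list \<times> int"
  \<comment> \<open>Column \<open>Inr l\<close> holds the slack of row \<open>l\<close>; for sign 0
    it vanishes, and the row becomes an equation.\<close>
  define a where "a l j = (case j of Inl x \<Rightarrow> lin_coeff (fst l) x
      | Inr l' \<Rightarrow> if l' = l then - e l else 0)" for l j
  \<comment> \<open>Slack 0 stands for distance 1, the least one for a nonzero sign; for sign 0 the
    truncation by \<open>nat\<close> yields 0.\<close>
  define z' where "z' j = (case j of Inl x \<Rightarrow> z x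
      | Inr l \<Rightarrow> nat (\<bar>lin_val z (fst l) - snd l\<bar> - 1))" for j
  define J where "J = V <+> L"
  have sumJ: "(\<Sum>j\<in>J. a (ts, c) j * int (q j))
      = lin_val (\<lambda>x. q (Inl x)) ts - e (ts, c) * int (q (Inr (ts, c)))" if "(ts, c) \<in> L" for q ts c
  proof -
    have "(\<Sum>l\<in>L. a (ts, c) (Inr l) * int (q (Inr l)))
        = (\<Sum>l\<in>L. if l = (ts, c) then - e (ts, c) * int (q (Inr (ts, c))) else 0)"
      by (intro sum.cong) (auto simp: a_def)
    also have "\<dots> = - e (ts, c) * int (q (Inr (ts, c)))" using assms(1) that by simp
    finally show ?thesis
      using V that assms(1) by (simp add: J_def sum.Plus lin_val_conv_coeff[OF V] a_def o_def)
  qed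
  \<comment> \<open>The slack cancels all of the distance beyond 1, so the right-hand side depends
    on \<open>z\<close> only through a sign and is bounded by \<open>\<beta> + 1\<close>.\<close>
  have rhs: "(\<Sum>j\<in>J. a (ts, c) j * int (z' j)) = c + e (ts, c)" if "(ts, c) \<in> L" for ts c
  proof -
    have "(\<lambda>x. z' (Inl x)) = z" by (simp add: z'_def)
    then show ?thesis
      by (subst sumJ[OF that]) (auto simp: z'_def e_def sgn_if)
  qed
  have "\<exists>p. (\<forall>j. p j \<le> z' j) \<and>
      (\<forall>l\<in>L. (\<Sum>j\<in>J. a l j * int (p j)) = (\<Sum>j\<in>J. a l j * int (z' j))) \<and>
      (\<Sum>j\<in>J. p j) \<le> (\<beta> + 1 + 2) * (2 * card L * D + 5) ^ card L"
  proof (rule exists_small_solution[OF assms(1)])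
    show "finite J" using V assms(1) by (simp add: J_def)
    show "\<forall>l\<in>L. \<forall>j\<in>J. \<bar>a l j\<bar> \<le> int D"
    proof (intro ballI)
      fix l j assume "l \<in> L" "j \<in> J"
      then show "\<bar>a l j\<bar> \<le> int D"
        using L[of "fst l" "snd l"] abs_lin_coeff_le[of "fst l"] assms(3)
        by (cases j) (auto simp: a_def e_def sgn_if split: prod.splits intro: order_trans)
    qed
    show "\<forall>l\<in>L. \<bar>\<Sum>j\<in>J. a l j * int (z' j)\<bar> \<le> int (\<beta> + 1)"
    proof
      fix l assume "l \<in> L"
      moreover obtain ts c where "l = (ts, c)" by (cases l)
      ultimately show "\<bar>\<Sum>j\<in>J. a l j * int (z' j)\<bar> \<le> int (\<beta> + 1)"
        using L[of ts c] rhs[of ts c] by (auto simp: e_def sgn_if)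
    qed
  qed
  then obtain p' where p'': "\<forall>j. p' j \<le> z' j"
    "\<forall>l\<in>L. (\<Sum>j\<in>J. a l j * int (p' j)) = (\<Sum>j\<in>J. a l j * int (z' j))"
    "(\<Sum>j\<in>J. p' j) \<le> (\<beta> + 1 + 2) * (2 * card L * D + 5) ^ card L" by blast
  have \<beta>3: "\<beta> + 1 + 2 = \<beta> + 3" by simp
  have p': "\<And>j. p' j \<le> z' j"
    "\<And>l. l \<in> L \<Longrightarrow> (\<Sum>j\<in>J. a l j * int (p' j)) = (\<Sum>j\<in>J. a l j * int (z' j))"
    "(\<Sum>j\<in>J. p' j) \<le> (\<beta> + 3) * (2 * card L * D + 5) ^ card L"
    using p'' unfolding \<beta>3 by blast+
  define p where "p x = (if x \<in> V then p' (Inl x) else 0)" for x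
  have "p x \<le> z x" for x using p'(1)[of "Inl x"] by (simp add: p_def z'_def)
  moreover have "p x \<le> (\<beta> + 3) * (2 * m * D + 5) ^ m" for x
  proof (cases "x \<in> V")
    case True
    then have "p x \<le> (\<Sum>j\<in>J. p' j)"
      using V(1) assms(1) member_le_sum[of "Inl x" J p'] by (auto simp: p_def J_def)
    also note p'(3)
    also have "(2 * card L * D + 5) ^ card L \<le> (2 * m * D + 5) ^ card L"
      using assms(2) by (intro power_mono) auto
    also have "(2 * m * D + 5) ^ card L \<le> (2 * m * D + 5) ^ m"
      using assms(2) by (intro power_increasing) auto
    finally show ?thesis by simp
  qed (simp add: p_def)
  moreover have "sgn (lin_val p ts - c) = sgn (lin_val z ts - c) \<and>
      (\<exists>k::nat. lin_val z ts - lin_val p ts = int k * sgn (lin_val z ts - c))"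
    if l: "(ts, c) \<in> L" for ts c
  proof -
    \<comment> \<open>The two values differ from \<open>c\<close> by the sign times
      \<open>1 + s\<close> and \<open>1 + s'\<close>; since \<open>s \<le> s'\<close>, their
      difference is a nonnegative multiple of the sign.\<close>
    define s s' where "s = p' (Inr (ts, c))" and "s' = z' (Inr (ts, c))"
    have ss: "s \<le> s'" using p'(1) by (simp add: s_def s'_def)
    have "lin_val p ts = lin_val (\<lambda>x. p' (Inl x)) ts"
      unfolding lin_val_conv_coeff[OF V(1) V(2)[OF l]] by (intro sum.cong) (auto simp: p_def)
    moreover have "lin_val (\<lambda>x. p' (Inl x)) ts - e (ts, c) * int s = c + e (ts, c)"
      using p'(2)[OF l] rhs[OF l] sumJ[OF l, of p'] by (simp add: s_def)
    ultimately have p: "lin_val p ts - c = e (ts, c) * (1 + int s)" by (simp add: algebra_simps)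
    have "(\<lambda>x. z' (Inl x)) = z" by (simp add: z'_def)
    then have z: "lin_val z ts - c = e (ts, c) * (1 + int s')"
      using rhs[OF l] sumJ[OF l, of z'] by (simp add: s'_def algebra_simps)
    have "sgn (lin_val p ts - c) = e (ts, c)"
      unfolding p by (simp add: sgn_mult) (simp add: e_def sgn_if)
    moreover have "lin_val z ts - lin_val p ts = int (s' - s) * e (ts, c)"
    proof -
      have "lin_val z ts - lin_val p ts = (lin_val z ts - c) - (lin_val p ts - c)" by simp
      also have "\<dots> = int (s' - s) * e (ts, c)" unfolding p z using ss by (simp add: of_nat_diff algebra_simps)
      finally show ?thesis .
    qed
    ultimately show ?thesis by (auto simp: e_def)
  qed
  ultimately show ?thesis by (intro exI[of _ p]) auto
qed

section \<open>Linear atoms and moduli of a formula\<close>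

fun lin_atoms :: "pform \<Rightarrow> ((int \<times> nat) list \<times> int) set" where
  "lin_atoms (Le ts b) = {(ts, b)}"
| "lin_atoms (Ge ts b) = {(ts, b)}"
| "lin_atoms (Conj \<phi> \<psi>) = lin_atoms \<phi> \<union> lin_atoms \<psi>"
| "lin_atoms (Neg \<phi>) = lin_atoms \<phi>"
| "lin_atoms _ = {}"

text \<open>A common multiple of all moduli of a quantifier-free formula; as a product it is at most
  exponential in the encoding length.\<close>

fun modulus :: "pform \<Rightarrow> nat" where
  "modulus (CongVars k a x b y) = k"
| "modulus (CongConst k x c) = k"
| "modulus (Conj \<phi> \<psi>) = modulus \<phi> * modulus \<psi>"
| "modulus (Neg \<phi>) = modulus \<phi>"
| "modulus _ = 1"

section \<open>Magnitudes in terms of the encoding length\<close>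

lemma less_two_power_nat_len: "n < 2 ^ nat_len n"
proof (cases "n = 0")
  case False
  then have "n < 2 ^ floorlog 2 n" using floorlog_bounds[of n 2] by simp
  also have "\<dots> \<le> 2 ^ nat_len n" by (intro power_increasing) (auto simp: nat_len_def)
  finally show ?thesis .
qed (simp add: nat_len_def)

lemma abs_less_two_power_int_len: "\<bar>z\<bar> < 2 ^ int_len z"
proof -
  have "\<bar>z\<bar> = int (nat \<bar>z\<bar>)" by simp
  also have "\<dots> < int (2 ^ nat_len (nat \<bar>z\<bar>))" using less_two_power_nat_len[of "nat \<bar>z\<bar>"] unfolding of_nat_less_iff .
  also have "\<dots> \<le> 2 ^ int_len z" by (simp add: int_len_def)
  finally show ?thesis .
qed

lemma lin_norm_less: "lin_norm ts < 2 ^ lin_len ts"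
proof (induction ts)
  case (Cons t ts)
  obtain a x where t: "t = (a, x)" by (cases t)
  have "1 + lin_norm (t # ts) = 1 + \<bar>a\<bar> + lin_norm ts" by (simp add: t lin_norm_def)
  also have "\<dots> \<le> (1 + \<bar>a\<bar>) * (1 + lin_norm ts)"
    using lin_norm_nonneg[of ts] by (simp add: distrib_left distrib_right)
  also have "\<dots> \<le> 2 ^ int_len a * 2 ^ lin_len ts"
    using abs_less_two_power_int_len[of a] Cons lin_norm_nonneg[of ts] by (intro mult_mono) auto
  also have "\<dots> = 2 ^ (int_len a + lin_len ts)" by (simp add: power_add)
  also have "\<dots> \<le> 2 ^ lin_len (t # ts)" by (intro power_increasing) (auto simp: t lin_len_def)
  finally show ?case by simp
qed (simp add: lin_norm_def lin_len_def)

lemma enc_len_pos: "0 < enc_len \<psi>"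
  by (cases \<psi>) auto

lemma finite_lin_atoms: "finite (lin_atoms \<psi>)"
  by (induction \<psi>) auto

lemma card_lin_atoms_le: "card (lin_atoms \<psi>) \<le> enc_len \<psi>"
proof (induction \<psi>)
  case (Conj \<phi> \<psi>)
  then show ?case using card_Un_le[of "lin_atoms \<phi>" "lin_atoms \<psi>"] by simp
qed auto

lemma lin_atoms_bound:
  assumes "(ts, b) \<in> lin_atoms \<psi>"
  shows "lin_norm ts \<le> 2 ^ enc_len \<psi> \<and> \<bar>b\<bar> \<le> 2 ^ enc_len \<psi>"
proof -
  have "lin_len ts \<le> enc_len \<psi> \<and> int_len b \<le> enc_len \<psi>"
    using assms by (induction \<psi>) auto
  then have "(2::int) ^ lin_len ts \<le> 2 ^ enc_len \<psi>" "(2::int) ^ int_len b \<le> 2 ^ enc_len \<psi>"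
    by (auto intro: power_increasing)
  then show ?thesis
    using lin_norm_less[of ts] abs_less_two_power_int_len[of b] by linarith
qed

lemma vars_lin_atoms: "(ts, b) \<in> lin_atoms \<psi> \<Longrightarrow> snd ` set ts \<subseteq> free_vars \<psi>"
  by (induction \<psi>) auto

lemma modulus_pos: "quantifier_free \<psi> \<Longrightarrow> 0 < modulus \<psi>"
  by (induction \<psi>) auto

lemma modulus_le: "modulus \<psi> \<le> 2 ^ enc_len \<psi>"
proof (induction \<psi>)
  case (CongVars k a x b y)
  have "k \<le> 2 ^ nat_len k" using less_two_power_nat_len[of k] by simp
  also have "\<dots> \<le> 2 ^ enc_len (CongVars k a x b y)" by (intro power_increasing) auto
  finally show ?case by simp
next
  case (CongConst k x c)
  have "k \<le> 2 ^ nat_len k" using less_two_power_nat_len[of k] by simp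
  also have "\<dots> \<le> 2 ^ enc_len (CongConst k x c)" by (intro power_increasing) auto
  finally show ?case by simp
next
  case (Conj \<phi> \<psi>)
  have "modulus (Conj \<phi> \<psi>) \<le> 2 ^ enc_len \<phi> * 2 ^ enc_len \<psi>"
    using Conj by (simp add: mult_le_mono)
  also have "\<dots> \<le> 2 ^ enc_len (Conj \<phi> \<psi>)" by (simp add: power_add)
  finally show ?case .
qed (auto intro: order_trans)

section \<open>Dependence of truth on signs and residues\<close>

lemma dvd_iff_if_dvd_diff: "k dvd s - t \<Longrightarrow> k dvd s \<longleftrightarrow> k dvd t" for k s t :: int
  using dvd_add_right_iff[of k "s - t" t] by simp

text \<open>Linear atoms depend only on the side of the bound on which the value lies, congruences
  only on the residues of the variables. This allows variables to change by multiples of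
  \<open>M\<close> as long as no linear atom changes its sign.\<close>

lemma sat_same_signs:
  assumes "quantifier_free \<psi>" "modulus \<psi> dvd M"
    and "\<And>ts b. (ts, b) \<in> lin_atoms \<psi> \<Longrightarrow> sgn (lin_val u ts - b) = sgn (lin_val v ts - b)"
    and "\<And>x. x \<in> free_vars \<psi> \<Longrightarrow> int M dvd int (u x) - int (v x)"
  shows "sat u \<psi> \<longleftrightarrow> sat v \<psi>"
  using assms
proof (induction \<psi>)
  case (Le ts b)
  then have "sgn (lin_val u ts - b) = sgn (lin_val v ts - b)" by simp
  then show ?case by (auto simp: sgn_if split: if_splits)
next
  case (Ge ts b)
  then have "sgn (lin_val u ts - b) = sgn (lin_val v ts - b)" by simp
  then show ?case by (auto simp: sgn_if split: if_splits)
next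
  case (CongVars k a x b y)
  then have "int k dvd int M" by simp
  then have k: "int k dvd int (u x) - int (v x)" "int k dvd int (u y) - int (v y)"
    using CongVars.prems(4)[of x] CongVars.prems(4)[of y] dvd_trans by auto
  have "(a * int (u x) - b * int (u y)) - (a * int (v x) - b * int (v y))
      = a * (int (u x) - int (v x)) - b * (int (u y) - int (v y))" by (simp add: algebra_simps)
  then have "int k dvd (a * int (u x) - b * int (u y)) - (a * int (v x) - b * int (v y))"
    using k by simp
  from dvd_iff_if_dvd_diff[OF this] show ?case by simp
next
  case (CongConst k x c)
  then have "int k dvd int M" by simp
  then have "int k dvd int (u x) - int (v x)" using CongConst.prems(4)[of x] dvd_trans by auto
  then have "int k dvd (int (u x) - int c) - (int (v x) - int c)" by simp
  from dvd_iff_if_dvd_diff[OF this] show ?case by simp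
next
  case (Conj \<phi> \<psi>)
  have "modulus \<phi> dvd M" "modulus \<psi> dvd M"
    using Conj.prems(2) dvd_mult_left dvd_mult_right by auto
  then show ?case using Conj by simp
qed auto

lemma lin_val_cong: "(\<And>x. x \<in> snd ` set ts \<Longrightarrow> u x = v x) \<Longrightarrow> lin_val u ts = lin_val v ts"
  unfolding lin_val_def by (intro arg_cong[of _ _ sum_list] map_cong) force+

lemma sat_cong:
  assumes "quantifier_free \<psi>" "\<And>x. x \<in> free_vars \<psi> \<Longrightarrow> u x = v x"
  shows "sat u \<psi> \<longleftrightarrow> sat v \<psi>"
proof (rule sat_same_signs[OF assms(1) dvd_refl])
  fix ts b assume "(ts, b) \<in> lin_atoms \<psi>"
  then have "lin_val u ts = lin_val v ts" using assms(2) vars_lin_atoms by (intro lin_val_cong) blast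
  then show "sgn (lin_val u ts - b) = sgn (lin_val v ts - b)" by simp
qed (use assms in simp)

section \<open>Restricting and combining linear forms\<close>

definition lin_proj :: "nat set \<Rightarrow> (int \<times> nat) list \<Rightarrow> (int \<times> nat) list" where
  "lin_proj V ts = [t \<leftarrow> ts. snd t \<in> V]"

lemma lin_val_proj:
  assumes "X \<inter> Y = {}" "snd ` set ts \<subseteq> X \<union> Y"
  shows "lin_val v ts = lin_val v (lin_proj X ts) + lin_val v (lin_proj Y ts)"
  using assms(2)
proof (induction ts)
  case (Cons t ts)
  then show ?case using assms(1) by (cases t) (auto simp: lin_val_def lin_proj_def)
qed (simp add: lin_val_def lin_proj_def)

lemma lin_norm_proj_le: "lin_norm (lin_proj V ts) \<le> lin_norm ts"
proof (induction ts)
  case (Cons t ts)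
  then show ?case by (cases t) (auto simp: lin_norm_def lin_proj_def)
qed (simp add: lin_norm_def lin_proj_def)

lemma vars_lin_proj: "snd ` set (lin_proj V ts) = snd ` set ts \<inter> V"
  by (auto simp: lin_proj_def)

lemma lin_val_add: "lin_val (\<lambda>x. u x + v x) ts = lin_val u ts + lin_val v ts"
  by (induction ts) (auto simp: lin_val_def algebra_simps)

lemma lin_val_mult: "lin_val (\<lambda>x. k * v x) ts = int k * lin_val v ts"
  by (induction ts) (auto simp: lin_val_def algebra_simps)

lemma lin_val_diff:
  assumes "\<And>x. p x \<le> v x"
  shows "lin_val (\<lambda>x. v x - p x) ts = lin_val v ts - lin_val p ts"
proof -
  have "lin_val v ts = lin_val (\<lambda>x. (v x - p x) + p x) ts" using assms by simp
  then show ?thesis by (simp only: lin_val_add)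
qed

lemma sgn_add_dominated: "\<bar>y\<bar> < \<bar>x\<bar> \<Longrightarrow> sgn (x + y) = sgn x" for x y :: int
  by (auto simp: sgn_if)

section \<open>Small witnesses\<close>

text \<open>Pigeonhole: the \<open>m + 1\<close> intervals between consecutive thresholds are
  disjoint, and at most \<open>m\<close> numbers cannot meet all of them.\<close>

lemma exists_gap:
  fixes T :: "nat \<Rightarrow> nat"
  assumes "mono T" "finite H" "card H \<le> m"
  shows "\<exists>j\<le>m. \<forall>h\<in>H. h \<le> T j \<or> T (Suc j) < h"
proof (rule ccontr)
  assume "\<not> ?thesis"
  then have "\<forall>j\<in>{..m}. \<exists>h. h \<in> H \<and> T j < h \<and> h \<le> T (Suc j)" by (meson atMost_iff not_le)
  then obtain g where g: "\<And>j. j \<le> m \<Longrightarrow> g j \<in> H \<and> T j < g j \<and> g j \<le> T (Suc j)"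
    by (metis atMost_iff)
  have "g i < g j" if "i < j" "j \<le> m" for i j
  proof -
    have "g i \<le> T (Suc i)" using g[of i] that by simp
    also have "\<dots> \<le> T j" using assms(1) that by (simp add: monoD)
    also have "\<dots> < g j" using g[of j] that by simp
    finally show ?thesis .
  qed
  then have "inj_on g {..m}" by (intro linorder_inj_onI) (auto simp: less_imp_neq)
  then have "card {..m} \<le> card H" using g assms(2) by (intro card_inj_on_le[of g]) auto
  then show False using assms(3) by simp
qed

text \<open>Pigeonhole on the disjuncts: infinitely many \<open>v t\<close> satisfy the same
  disjunct as some \<open>v s\<close>. Its \<open>\<Delta>\<close> sees only \<open>X\<close> and
  its \<open>\<chi>\<close> only \<open>Y\<close>, so the \<open>X\<close>-part of
  \<open>v s\<close> can be combined with the \<open>Y\<close>-part of \<open>v t\<close>.\<close>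

lemma decomposable_mix:
  assumes ds: "\<forall>(\<Delta>, \<chi>) \<in> set ds. quantifier_free \<Delta> \<and> free_vars \<Delta> \<subseteq> X \<and>
      quantifier_free \<chi> \<and> free_vars \<chi> \<subseteq> Y"
    and eq: "\<forall>v. sat v \<psi> \<longleftrightarrow> (\<exists>(\<Delta>, \<chi>) \<in> set ds. sat v \<Delta> \<and> sat v \<chi>)"
    and "X \<inter> Y = {}" "\<And>t::nat. sat (v t) \<psi>"
  shows "\<exists>s. \<forall>n. \<exists>t\<ge>n. sat (\<lambda>x. if x \<in> X then v s x else v t x) \<psi>"
proof -
  have "\<forall>t. \<exists>d\<in>set ds. sat (v t) (fst d) \<and> sat (v t) (snd d)" 
  proof
    fix t
    show "\<exists>d\<in>set ds. sat (v t) (fst d) \<and> sat (v t) (snd d)"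
      using eq[rule_format, of "v t"] assms(4)[of t] by (auto simp: case_prod_beta')
  qed
  then obtain g where g: "\<And>t. g t \<in> set ds" "\<And>t. sat (v t) (fst (g t)) \<and> sat (v t) (snd (g t))"
    by metis
  have "finite (range g)" using g(1) by (meson List.finite_set finite_subset image_subsetI)
  then obtain s where inf: "infinite {t \<in> UNIV. g t = g s}"
    using pigeonhole_infinite[of UNIV g] infinite_UNIV_nat by blast
  have "sat (\<lambda>x. if x \<in> X then v s x else v t x) \<psi>" if "g t = g s" for t
  proof -
    obtain \<Delta> \<chi> where d: "g s = (\<Delta>, \<chi>)" by (cases "g s")
    then have D: "quantifier_free \<Delta>" "free_vars \<Delta> \<subseteq> X" "quantifier_free \<chi>" "free_vars \<chi> \<subseteq> Y"
      "(\<Delta>, \<chi>) \<in> set ds" using ds g(1)[of s] by auto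
    have "sat (\<lambda>x. if x \<in> X then v s x else v t x) \<Delta> = sat (v s) \<Delta>"
      using D by (intro sat_cong) auto
    moreover have "sat (\<lambda>x. if x \<in> X then v s x else v t x) \<chi> = sat (v t) \<chi>"
      using D assms(3) by (intro sat_cong) auto
    ultimately show ?thesis using g(2)[of s] g(2)[of t] that d D(5) eq by auto
  qed
  moreover have "\<exists>t\<ge>n. g t = g s" for n
    using inf unfolding infinite_nat_iff_unbounded_le by auto
  ultimately show ?thesis by blast
qed

text \<open>As \<open>t\<close> enters the bound on small solutions only linearly, the next
  threshold can exceed it by a factor that depends on \<open>e\<close> alone. The left-hand side is
  to dominate the \<open>X\<close>-part of an atom at a small solution together with the constant of
  the atom.\<close>

lemma threshold_step:
  fixes e t :: nat
  defines "E \<equiv> (2::nat) ^ e"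
  assumes "1 \<le> e" "E \<le> t"
  shows "E\<^sup>2 * (1 + (E\<^sup>2 + E + t + 3) * (2 * (2 * e) * E\<^sup>2 + 5) ^ (2 * e)) + E \<le> t * 2 ^ (22 * e\<^sup>2)"
proof -
  define G where "G = (2 * (2 * e) * E\<^sup>2 + 5) ^ (2 * e)"
  have E2: "2 \<le> E" unfolding E_def using assms(2) self_le_power[of 2 e] by simp
  have eE: "e \<le> E" unfolding E_def by (simp add: less_imp_le)
  have "3 * e = e + (e + e)" by simp
  then have E3: "2 ^ (3 * e) = E * E\<^sup>2" by (simp only: power_add E_def power2_eq_square)
  \<comment> \<open>With \<open>e \<le> E\<close>, the base is at most
    \<open>16 * E ^ 3 = 2 ^ (4 + 3 * e)\<close>; raising it to the power \<open>2 * e\<close>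
    accounts for \<open>14 * e\<^sup>2\<close>.\<close>
  have "2 * (2 * e) * E\<^sup>2 + 5 \<le> 16 * (E * E\<^sup>2)"
  proof -
    have "e * E\<^sup>2 \<le> E * E\<^sup>2" using eE by simp
    moreover have "1 \<le> E * E\<^sup>2" using E2 by simp
    moreover have "2 * (2 * e) * E\<^sup>2 = 4 * (e * E\<^sup>2)" by simp
    ultimately show ?thesis by linarith
  qed
  also have "\<dots> = 2 ^ (4 + 3 * e)"
    by (simp add: E3 power_add)
  also have "\<dots> \<le> 2 ^ (7 * e)" using assms(2) by (intro power_increasing) auto
  finally have "G \<le> (2 ^ (7 * e)) ^ (2 * e)" unfolding G_def by (rule power_mono) simp
  also have "\<dots> = 2 ^ (14 * e\<^sup>2)" by (simp add: power2_eq_square flip: power_mult)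
  finally have G: "G \<le> 2 ^ (14 * e\<^sup>2)" .
  have G1: "1 \<le> G" by (simp add: G_def)
  have "E\<^sup>2 + E + t + 3 \<le> 8 * E * t"
  proof -
    have "E\<^sup>2 \<le> E * t" using assms(3) by (simp add: power2_eq_square)
    moreover have "E \<le> E * t" "t \<le> E * t" using E2 assms(3) by auto
    moreover have "2 * 2 \<le> E * t" using E2 assms(3) by (intro mult_le_mono) auto
    moreover have "8 * E * t = 8 * (E * t)" by simp
    ultimately show ?thesis by linarith
  qed
  then have "1 + (E\<^sup>2 + E + t + 3) * G \<le> 1 + 8 * E * t * G" by simp
  also have "\<dots> \<le> 16 * E * t * G"
  proof -
    have "1 \<le> E * t * G" using E2 assms(3) G1 by (simp add: Suc_le_eq)
    then show ?thesis by simp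
  qed
  finally have "E\<^sup>2 * (1 + (E\<^sup>2 + E + t + 3) * G) + E \<le> E\<^sup>2 * (16 * E * t * G) + E"
    by (intro add_mono mult_le_mono order_refl)
  also have "\<dots> \<le> 32 * E * E\<^sup>2 * t * G"
  proof -
    have "E * 1 \<le> E * (E\<^sup>2 * t * G)" using E2 assms(3) G1 by (intro mult_le_mono) (auto simp: Suc_le_eq)
    moreover have "E\<^sup>2 * (16 * E * t * G) = 16 * (E * (E\<^sup>2 * t * G))"
      "32 * E * E\<^sup>2 * t * G = 32 * (E * (E\<^sup>2 * t * G))" by simp_all
    ultimately show ?thesis by linarith
  qed
  also have "\<dots> = t * (32 * E * E\<^sup>2 * G)" by simp
  also have "\<dots> \<le> t * (32 * E * E\<^sup>2 * 2 ^ (14 * e\<^sup>2))" using G by (intro mult_le_mono order_refl)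
  also have "32 * E * E\<^sup>2 * 2 ^ (14 * e\<^sup>2) = 2 ^ (5 + 3 * e + 14 * e\<^sup>2)"
    by (simp add: E3 power_add)
  \<comment> \<open>The factor \<open>32 * E ^ 3\<close> adds \<open>5 + 3 * e\<close>, and 22 = 5 +
    3 + 14.\<close>
  also have "(2::nat) ^ (5 + 3 * e + 14 * e\<^sup>2) \<le> 2 ^ (22 * e\<^sup>2)"
  proof (rule power_increasing)
    have "e * 1 \<le> e * e" using assms(2) by (intro mult_le_mono) auto
    moreover have "1 * 1 \<le> e * e" using assms(2) by (intro mult_le_mono) auto
    ultimately show "5 + 3 * e + 14 * e\<^sup>2 \<le> 22 * e\<^sup>2" unfolding power2_eq_square by linarith
  qed simp
  finally show ?thesis by (simp add: G_def)
qed

lemma sgn_add_multiple_sgn: "sgn (x + int k * sgn x) = sgn x" for x :: int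
  by (auto simp: sgn_if)

lemma add_multiple_same_sgn:
  fixes x y :: int
  assumes "sgn y = sgn x" "x \<noteq> 0"
  shows "sgn (x + int k * y) = sgn x \<and> int k < \<bar>x + int k * y\<bar>"
proof -
  have y: "y = sgn x * \<bar>y\<bar>" "1 \<le> \<bar>y\<bar>" using assms by (auto simp: sgn_if split: if_splits)
  have k: "int k * 1 \<le> int k * \<bar>y\<bar>" using y(2) by (intro mult_left_mono) auto
  have "x + int k * y = sgn x * (\<bar>x\<bar> + int k * \<bar>y\<bar>)"
    by (subst y(1)) (simp add: algebra_simps abs_mult_sgn)
  then show ?thesis using assms(2) k by (auto simp: sgn_if)
qed

section \<open>A witness of bounded size\<close>

text \<open>Writing \<open>x\<close> as remainder plus modulus times quotient turns a row for the
  values into one for the quotients, with coefficients multiplied by the modulus.\<close>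

definition lin_scale :: "nat \<Rightarrow> (int \<times> nat) list \<Rightarrow> (int \<times> nat) list" where
  "lin_scale k ts = map (\<lambda>(a, x). (a * int k, x)) ts"

lemma lin_val_scale: "lin_val v (lin_scale k ts) = int k * lin_val v ts"
  by (induction ts) (auto simp: lin_scale_def lin_val_def algebra_simps)

lemma lin_norm_scale: "lin_norm (lin_scale k ts) = int k * lin_norm ts"
  by (induction ts) (auto simp: lin_scale_def lin_norm_def algebra_simps abs_mult)

text \<open>The cubic exponent arises because the gap is found among \<open>e + 1\<close> intervals,
  whose endpoints grow by a factor of \<open>2 ^ (22 * e\<^sup>2)\<close> each.\<close>

lemma exists_small_witness:
  assumes qf: "quantifier_free \<psi>" and XY: "X \<inter> Y = {}" "free_vars \<psi> \<subseteq> X \<union> Y"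
    and ds: "\<forall>(\<Delta>, \<chi>) \<in> set ds. quantifier_free \<Delta> \<and> free_vars \<Delta> \<subseteq> X \<and>
      quantifier_free \<chi> \<and> free_vars \<chi> \<subseteq> Y"
      "\<forall>v. sat v \<psi> \<longleftrightarrow> (\<exists>(\<Delta>, \<chi>) \<in> set ds. sat v \<Delta> \<and> sat v \<chi>)"
    and v: "sat v \<psi>"
  shows "\<exists>u. sat u \<psi> \<and> (\<forall>x. x \<notin> X \<longrightarrow> u x = v x) \<and> (\<forall>x\<in>X. u x \<le> 2 ^ (45 * enc_len \<psi> ^ 3))"
proof -
  define e where "e = enc_len \<psi>"
  define E where "E = (2::nat) ^ e"
  define M where "M = modulus \<psi>"
  define A where "A = lin_atoms \<psi>"
  define h where "h ts = lin_val v (lin_proj Y ts)" for ts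
  have e1: "1 \<le> e" using enc_len_pos[of \<psi>] by (simp add: e_def)
  have M: "0 < M" "M \<le> E" using modulus_pos[OF qf] modulus_le[of \<psi>] by (simp_all add: M_def E_def e_def)
  have A: "finite A" "card A \<le> e" using finite_lin_atoms card_lin_atoms_le by (auto simp: A_def e_def)
  have norm: "lin_norm ts \<le> int E" and const: "\<bar>b\<bar> \<le> int E" if "(ts, b) \<in> A" for ts b
    using lin_atoms_bound[of ts b \<psi>] that by (auto simp: A_def E_def e_def)
  have normP: "lin_norm (lin_proj V ts) \<le> int E" if "(ts, b) \<in> A" for V ts b
    using norm[OF that] lin_norm_proj_le[of V ts] by linarith
  have split: "lin_val w ts = lin_val w (lin_proj X ts) + lin_val w (lin_proj Y ts)"
    if "(ts, b) \<in> A" for w ts b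
    using vars_lin_atoms[of ts b \<psi>] that XY by (intro lin_val_proj) (auto simp: A_def)
  have on_X: "lin_val w (lin_proj X ts) = lin_val w' (lin_proj X ts)"
    if "\<And>x. x \<in> X \<Longrightarrow> w x = w' x" for w w' ts
    using that by (intro lin_val_cong) (auto simp: vars_lin_proj)
  have on_Y: "lin_val w (lin_proj Y ts) = lin_val w' (lin_proj Y ts)"
    if "\<And>x. x \<in> Y \<Longrightarrow> w x = w' x" for w w' ts
    using that by (intro lin_val_cong) (auto simp: vars_lin_proj)

  \<comment> \<open>\<open>T 0 = E\<close>, and the ratio is that of
    \<open>threshold_step\<close>.\<close>
  define T where "T j = (2::nat) ^ (e + 22 * e\<^sup>2 * j)" for j
  have "mono T" by (auto simp: T_def mono_def intro!: power_increasing)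
  then obtain j where j: "j \<le> e" "\<forall>k\<in>(\<lambda>(ts, b). nat \<bar>h ts\<bar>) ` A. k \<le> T j \<or> T (Suc j) < k"
    using exists_gap[of T "(\<lambda>(ts, b). nat \<bar>h ts\<bar>) ` A" e] A card_image_le[OF A(1), of "\<lambda>(ts, b). nat \<bar>h ts\<bar>"]
    by (meson finite_imageI order_trans)
  define t where "t = T j"
  define t' where "t' = T (Suc j)"
  define small where "small ts \<longleftrightarrow> nat \<bar>h ts\<bar> \<le> t" for ts
  have large: "int t' < \<bar>h ts\<bar>" if "(ts, b) \<in> A" "\<not> small ts" for ts b
  proof -
    have "t' < nat \<bar>h ts\<bar>" using j(2) that unfolding small_def t_def t'_def by force
    then show ?thesis by linarith
  qed
  have Et: "E \<le> t" unfolding E_def t_def T_def by (intro power_increasing) auto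
  \<comment> \<open>Bound for both small solutions below. The first system has two families of at
    most \<open>e\<close> rows; the rows of the second are scaled by \<open>M \<le> E\<close>, hence
    the norm \<open>E\<^sup>2\<close>. In the right-hand sides, remainders contribute at most
    \<open>E\<^sup>2\<close>, constants \<open>E\<close> and small \<open>Y\<close>-parts
    \<open>t\<close>.\<close>
  define N where "N = (E\<^sup>2 + E + t + 3) * (2 * (2 * e) * E\<^sup>2 + 5) ^ (2 * e)"
  have t': "E\<^sup>2 * (1 + N) + E \<le> t'"
  proof -
    have "t' = t * 2 ^ (22 * e\<^sup>2)" by (simp add: t_def t'_def T_def power_add)
    then show ?thesis using threshold_step[of e t] e1 Et by (simp add: N_def E_def)
  qed
  have E1: "1 \<le> E" by (simp add: E_def)
  have EE: "E \<le> E\<^sup>2" using E1 by (simp add: power2_eq_square)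
  then have EE': "int E \<le> int (E\<^sup>2)" by (rule of_nat_mono)

  \<comment> \<open>Besides all atoms, the small \<open>Y\<close>-parts enter as rows whose bound is
    their own value: their sign is 0, so that \<open>p\<close> attains the same value.\<close>
  define L where "L = A \<union> (\<lambda>(ts, b). (lin_proj Y ts, h ts)) ` {(ts, b) \<in> A. small ts}"
  have subA: "finite {(ts, b) \<in> A. small ts}" "card {(ts, b) \<in> A. small ts} \<le> e"
  proof -
    have sub: "{(ts, b) \<in> A. small ts} \<subseteq> A" by auto
    show "finite {(ts, b) \<in> A. small ts}" using A(1) sub by (rule finite_subset[rotated])
    show "card {(ts, b) \<in> A. small ts} \<le> e" using card_mono[OF A(1) sub] A(2) by simp
  qed
  have "\<exists>p. (\<forall>x. p x \<le> v x \<and> p x \<le> (E\<^sup>2 + E + t + 3) * (2 * (2 * e) * E\<^sup>2 + 5) ^ (2 * e)) \<and>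
      (\<forall>(ts, c) \<in> L. sgn (lin_val p ts - c) = sgn (lin_val v ts - c) \<and>
         (\<exists>k::nat. lin_val v ts - lin_val p ts = int k * sgn (lin_val v ts - c)))"
  proof (rule exists_small_same_signs)
    show "finite L" using A subA by (simp add: L_def)
    have "card L \<le> card A + card {(ts, b) \<in> A. small ts}"
      unfolding L_def by (rule order_trans[OF card_Un_le]) (simp add: card_image_le subA(1))
    then show "card L \<le> 2 * e" using A subA by simp
    show "1 \<le> E\<^sup>2" using E1 EE by simp
    fix ts c assume "(ts, c) \<in> L"
    then consider "(ts, c) \<in> A" | ts' b where "(ts', b) \<in> A" "small ts'" "ts = lin_proj Y ts'" "c = h ts'"
      unfolding L_def by auto
    then show "lin_norm ts \<le> int (E\<^sup>2) \<and> \<bar>c\<bar> \<le> int (E\<^sup>2 + E + t)"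
    proof cases
      case 1
      have "lin_norm ts \<le> int (E\<^sup>2)" using norm[OF 1] EE' by linarith
      moreover have "\<bar>c\<bar> \<le> int (E\<^sup>2 + E + t)" using const[OF 1] by linarith
      ultimately show ?thesis ..
    next
      case 2
      then have "nat \<bar>c\<bar> \<le> t" by (simp add: small_def)
      then have "\<bar>c\<bar> \<le> int (E\<^sup>2 + E + t)" by linarith
      moreover have "lin_norm ts \<le> int (E\<^sup>2)" using normP[OF 2(1), of Y] EE' unfolding 2(3) by linarith
      ultimately show ?thesis by simp
    qed
  qed
  then obtain p where p: "\<And>x. p x \<le> v x" "\<And>x. p x \<le> N"
    and pL: "\<And>ts c. (ts, c) \<in> L \<Longrightarrow> \<exists>k::nat. lin_val v ts - lin_val p ts = int k * sgn (lin_val v ts - c)"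
    unfolding N_def by blast
  define d where "d x = v x - p x" for x
  have d: "lin_val d ts = lin_val v ts - lin_val p ts" for ts
    unfolding d_def using p(1) by (rule lin_val_diff)
  \<comment> \<open>Steps in multiples of \<open>M\<close> keep all residues.\<close>
  define ray where "ray n x = v x + n * M * d x" for n x
  have ray: "lin_val (ray n) ts = lin_val v ts + int (n * M) * lin_val d ts" for n ts
    unfolding ray_def by (simp only: lin_val_add lin_val_mult)
  have ray_sat: "sat (ray n) \<psi>" for n
  proof -
    have "sat (ray n) \<psi> \<longleftrightarrow> sat v \<psi>"
    proof (rule sat_same_signs[OF qf])
      show "modulus \<psi> dvd M" by (simp add: M_def)
      fix ts b assume "(ts, b) \<in> lin_atoms \<psi>"
      then have "(ts, b) \<in> L" by (simp add: L_def A_def)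
      then obtain k :: nat where "lin_val d ts = int k * sgn (lin_val v ts - b)"
        using pL d by metis
      then have "lin_val (ray n) ts - b = (lin_val v ts - b) + int (n * M * k) * sgn (lin_val v ts - b)"
        by (simp add: ray)
      also have "sgn \<dots> = sgn (lin_val v ts - b)" by (rule sgn_add_multiple_sgn)
      finally show "sgn (lin_val (ray n) ts - b) = sgn (lin_val v ts - b)" .
    qed (simp add: ray_def)
    then show ?thesis using v by simp
  qed
  have ray_small: "lin_val (ray n) (lin_proj Y ts) = h ts" if "(ts, b) \<in> A" "small ts" for n ts b
  proof -
    have "(lin_proj Y ts, h ts) \<in> L" using that by (force simp: L_def)
    then have "lin_val d (lin_proj Y ts) = 0" using pL d by (fastforce simp: h_def)
    then show ?thesis by (simp add: ray h_def)
  qed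
  have ray_large: "sgn (lin_val (ray n) (lin_proj Y ts)) = sgn (h ts)"
      "int n < \<bar>lin_val (ray n) (lin_proj Y ts)\<bar>" if "(ts, b) \<in> A" "\<not> small ts" for n ts b
  proof -
    \<comment> \<open>At \<open>p\<close> the \<open>Y\<close>-part is at most \<open>t'\<close> and
      thus dominated by \<open>h ts\<close>. So \<open>d\<close> carries the sign of
      \<open>h ts\<close>, and each step along the ray moves the \<open>Y\<close>-part away from
      0.\<close>
    have "\<bar>lin_val p (lin_proj Y ts)\<bar> \<le> lin_norm (lin_proj Y ts) * int N"
      using p(2) by (intro abs_lin_val_le) auto
    also have "\<dots> \<le> int E * int N" using normP[OF that(1)] by (intro mult_right_mono) auto
    also have "\<dots> \<le> int (E\<^sup>2) * int (1 + N)" using EE by (intro mult_mono) auto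
    also have "\<dots> \<le> int t'" using t' by (metis add_leD1 of_nat_le_iff of_nat_mult)
    also have "\<dots> < \<bar>h ts\<bar>" using large[OF that] .
    finally have less: "\<bar>- lin_val p (lin_proj Y ts)\<bar> < \<bar>h ts\<bar>" by simp
    define \<delta> where "\<delta> = lin_val d (lin_proj Y ts)"
    have "sgn \<delta> = sgn (h ts)"
      unfolding \<delta>_def d using sgn_add_dominated[OF less] by (simp add: h_def)
    moreover have "h ts \<noteq> 0" using less by linarith
    ultimately have "sgn (h ts + int (n * M) * \<delta>) = sgn (h ts) \<and> int (n * M) < \<bar>h ts + int (n * M) * \<delta>\<bar>"
      by (rule add_multiple_same_sgn)
    moreover have "lin_val (ray n) (lin_proj Y ts) = h ts + int (n * M) * \<delta>"
      by (simp add: ray h_def \<delta>_def)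
    moreover have "int n \<le> int (n * M)" using M by (intro of_nat_mono) simp
    ultimately show "sgn (lin_val (ray n) (lin_proj Y ts)) = sgn (h ts)"
      "int n < \<bar>lin_val (ray n) (lin_proj Y ts)\<bar>" by (metis, metis le_less_trans)
  qed

  obtain s where s: "\<And>n. \<exists>k\<ge>n. sat (\<lambda>x. if x \<in> X then ray s x else ray k x) \<psi>"
    using decomposable_mix[OF ds XY(1), of ray, OF ray_sat] by blast
  define n0 where "n0 = (\<Sum>(ts, b)\<in>A. nat \<bar>lin_val (ray s) (lin_proj X ts) - b\<bar>)"
  have n0: "\<bar>lin_val (ray s) (lin_proj X ts) - b\<bar> \<le> int n0" if "(ts, b) \<in> A" for ts b
  proof -
    have "nat \<bar>lin_val (ray s) (lin_proj X ts) - b\<bar> \<le> n0"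
      using member_le_sum[of "(ts, b)" A "\<lambda>(ts, b). nat \<bar>lin_val (ray s) (lin_proj X ts) - b\<bar>"] that A
      by (simp add: n0_def)
    then show ?thesis by linarith
  qed
  obtain n where n: "n0 \<le> n" "sat (\<lambda>x. if x \<in> X then ray s x else ray n x) \<psi>" using s by blast
  \<comment> \<open>A reference point only: its truth is transferred to \<open>u\<close>, which has
    the original \<open>Y\<close>-values.\<close>
  define w where "w x = (if x \<in> X then ray s x else ray n x)" for x
  have w: "sat w \<psi>" using n(2) unfolding w_def .
  have wX: "lin_val w (lin_proj X ts) = lin_val (ray s) (lin_proj X ts)" for ts
    by (rule on_X) (simp add: w_def)
  have wY: "lin_val w (lin_proj Y ts) = lin_val (ray n) (lin_proj Y ts)" for ts
    using XY(1) by (intro on_Y) (auto simp: w_def)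

  \<comment> \<open>The remainders are kept and only the quotients are made small, so that
    \<open>u\<close> has the residues of \<open>w\<close> on \<open>X\<close>.\<close>
  define r where "r x = ray s x mod M" for x
  define z where "z x = ray s x div M" for x
  define sc where "sc ts = lin_scale M (lin_proj X ts)" for ts
  have sc: "lin_val q (sc ts) = int M * lin_val q (lin_proj X ts)" for q ts
    by (simp add: sc_def lin_val_scale)
  have sc_norm: "lin_norm (sc ts) = int M * lin_norm (lin_proj X ts)" for ts
    by (simp add: sc_def lin_norm_scale)
  \<comment> \<open>What is left of the bound for the quotients after the \<open>Y\<close>-part and
    the contribution of the remainders are subtracted.\<close>
  define rhs where "rhs ts b = b - h ts - lin_val r (lin_proj X ts)" for ts b
  define L' where "L' = (\<lambda>(ts, b). (sc ts, rhs ts b)) ` {(ts, b) \<in> A. small ts}"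
  have "\<exists>p. (\<forall>x. p x \<le> z x \<and> p x \<le> (E\<^sup>2 + E + t + 3) * (2 * (2 * e) * E\<^sup>2 + 5) ^ (2 * e)) \<and>
      (\<forall>(ts, c) \<in> L'. sgn (lin_val p ts - c) = sgn (lin_val z ts - c) \<and>
         (\<exists>k::nat. lin_val z ts - lin_val p ts = int k * sgn (lin_val z ts - c)))"
  proof (rule exists_small_same_signs)
    show "finite L'" using subA by (simp add: L'_def)
    have "card L' \<le> card {(ts, b) \<in> A. small ts}"
      unfolding L'_def by (rule card_image_le[OF subA(1)])
    then show "card L' \<le> 2 * e" using subA(2) by linarith
    show "1 \<le> E\<^sup>2" using E1 EE by simp
    fix ts c assume "(ts, c) \<in> L'"
    then obtain ts' b where ts: "(ts', b) \<in> A" "small ts'" "ts = sc ts'" "c = rhs ts' b"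
      unfolding L'_def by auto
    have "lin_norm ts \<le> int E * int E"
      unfolding ts sc_norm using M normP[OF ts(1)] lin_norm_nonneg by (intro mult_mono) auto
    moreover have "\<bar>lin_val r (lin_proj X ts')\<bar> \<le> lin_norm (lin_proj X ts') * int M"
      using M by (intro abs_lin_val_le) (auto simp: r_def intro: less_imp_le)
    moreover have "\<dots> \<le> int E * int E"
      using M normP[OF ts(1)] lin_norm_nonneg by (intro mult_mono) auto
    moreover have "\<bar>h ts'\<bar> \<le> int t" using ts(2) unfolding small_def by linarith
    moreover have "\<bar>b\<bar> \<le> int E" using const[OF ts(1)] .
    ultimately have "lin_norm ts \<le> int E * int E" "\<bar>c\<bar> \<le> int E * int E + int E + int t"
      unfolding ts rhs_def by linarith+
    then show "lin_norm ts \<le> int (E\<^sup>2) \<and> \<bar>c\<bar> \<le> int (E\<^sup>2 + E + t)"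
      by (simp add: power2_eq_square)
  qed
  then obtain q where q: "\<And>x. q x \<le> N"
    and qL: "\<And>ts c. (ts, c) \<in> L' \<Longrightarrow> sgn (lin_val q ts - c) = sgn (lin_val z ts - c)"
    unfolding N_def by blast
  define u where "u x = (if x \<in> X then r x + M * q x else v x)" for x
  have uX: "lin_val u (lin_proj X ts) = lin_val r (lin_proj X ts) + int M * lin_val q (lin_proj X ts)" for ts
  proof -
    have "lin_val u (lin_proj X ts) = lin_val (\<lambda>x. r x + M * q x) (lin_proj X ts)"
      by (rule on_X) (simp add: u_def)
    then show ?thesis by (simp only: lin_val_add lin_val_mult)
  qed
  have uY: "lin_val u (lin_proj Y ts) = h ts" for ts
    unfolding h_def using XY(1) by (intro on_Y) (auto simp: u_def)
  have u_le: "u x \<le> E * (1 + N)" if "x \<in> X" for x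
  proof -
    have "u x \<le> M * (1 + N)"
      using that q[of x] M(1) by (simp add: u_def r_def add_mono less_imp_le)
    also have "\<dots> \<le> E * (1 + N)" using M(2) by (rule mult_le_mono1)
    finally show ?thesis .
  qed
  have "sat u \<psi> \<longleftrightarrow> sat w \<psi>"
  proof (rule sat_same_signs[OF qf])
    show "modulus \<psi> dvd M" by (simp add: M_def)
    fix ts b assume "(ts, b) \<in> lin_atoms \<psi>"
    then have tsb: "(ts, b) \<in> A" by (simp add: A_def)
    show "sgn (lin_val u ts - b) = sgn (lin_val w ts - b)"
    proof (cases "small ts")
      case True
      \<comment> \<open>Here \<open>u\<close> and \<open>w\<close> have the same
        \<open>Y\<close>-part \<open>h ts\<close>, so the row for the quotients decides.\<close>
      then have "(sc ts, rhs ts b) \<in> L'" using tsb by (force simp: L'_def)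
      then have "sgn (lin_val q (sc ts) - rhs ts b) = sgn (lin_val z (sc ts) - rhs ts b)" by (rule qL)
      moreover have "lin_val u ts - b = lin_val q (sc ts) - rhs ts b"
        by (simp add: split[OF tsb] uX uY sc rhs_def)
      moreover have "lin_val (ray s) (lin_proj X ts)
          = lin_val r (lin_proj X ts) + int M * lin_val z (lin_proj X ts)"
      proof -
        have "ray s = (\<lambda>x. r x + M * z x)" by (auto simp: r_def z_def)
        then show ?thesis by (simp only: lin_val_add lin_val_mult)
      qed
      then have "lin_val w ts - b = lin_val z (sc ts) - rhs ts b"
        by (simp add: split[OF tsb] wX wY ray_small[OF tsb True] sc rhs_def)
      ultimately show ?thesis by simp
    next
      case False
      \<comment> \<open>Both atoms have the sign of \<open>h ts\<close>: for \<open>u\<close>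
        because \<open>h ts\<close> lies above the gap, for \<open>w\<close> because
        \<open>n\<close> was chosen beyond \<open>n0\<close>.\<close>
      have "\<bar>lin_val u (lin_proj X ts)\<bar> \<le> lin_norm (lin_proj X ts) * int (E * (1 + N))"
        using u_le by (intro abs_lin_val_le) (auto simp: vars_lin_proj)
      also have "\<dots> \<le> int E * int (E * (1 + N))"
        using normP[OF tsb] by (intro mult_right_mono) auto
      also have "\<dots> = int (E\<^sup>2 * (1 + N))" by (simp add: power2_eq_square algebra_simps)
      finally have "\<bar>lin_val u (lin_proj X ts) - b\<bar> \<le> int (E\<^sup>2 * (1 + N) + E)"
        using const[OF tsb] by linarith
      also have "\<dots> \<le> int t'" using t' by (rule of_nat_mono)
      also have "\<dots> < \<bar>h ts\<bar>" using large[OF tsb False] .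
      finally have "sgn (h ts + (lin_val u (lin_proj X ts) - b)) = sgn (h ts)"
        by (rule sgn_add_dominated)
      moreover have "sgn (lin_val (ray n) (lin_proj Y ts) + (lin_val w (lin_proj X ts) - b))
          = sgn (lin_val (ray n) (lin_proj Y ts))"
      proof (rule sgn_add_dominated)
        have "\<bar>lin_val w (lin_proj X ts) - b\<bar> \<le> int n0" using n0[OF tsb] by (simp add: wX)
        also have "\<dots> \<le> int n" using n(1) by simp
        also have "\<dots> < \<bar>lin_val (ray n) (lin_proj Y ts)\<bar>" using ray_large[OF tsb False] by simp
        finally show "\<bar>lin_val w (lin_proj X ts) - b\<bar> < \<bar>lin_val (ray n) (lin_proj Y ts)\<bar>" .
      qed
      ultimately show ?thesis
        using ray_large(1)[OF tsb False, of n] by (simp add: split[OF tsb] uY wY algebra_simps)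
    qed
  next
    fix x
    have "int M dvd int (r x + M * q x) - int (ray s x)"
    proof -
      have "int (ray s x) = int (r x + M * z x)" by (simp add: r_def z_def)
      then have "int (r x + M * q x) - int (ray s x) = int M * (int (q x) - int (z x))"
        by (simp add: algebra_simps)
      then show ?thesis by simp
    qed
    moreover have "int M dvd int (v x) - int (ray n x)" by (simp add: ray_def)
    ultimately show "int M dvd int (u x) - int (w x)" by (simp add: u_def w_def)
  qed
  moreover have "u x \<le> 2 ^ (45 * e ^ 3)" if "x \<in> X" for x
  proof -
    have "u x \<le> E * (1 + N)" using u_le that .
    also have "\<dots> \<le> E\<^sup>2 * (1 + N) + E" using EE by (intro trans_le_add1 mult_le_mono1)
    also note t'
    \<comment> \<open>As \<open>j \<le> e\<close>, the exponent is at most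
      \<open>e + 22 * e\<^sup>2 + 22 * e ^ 3\<close>, and 45 = 1 + 22 + 22.\<close>
    also have "t' \<le> 2 ^ (45 * e ^ 3)" unfolding t'_def T_def
    proof (rule power_increasing)
      have "e\<^sup>2 * j \<le> e\<^sup>2 * e" using j(1) by simp
      moreover have "e\<^sup>2 * 1 \<le> e\<^sup>2 * e" using e1 by (intro mult_le_mono) auto
      moreover have "e * 1 \<le> e * e" using e1 by (intro mult_le_mono) auto
      moreover have "e * e = e\<^sup>2" by (simp add: power2_eq_square)
      moreover have "e ^ 3 = e\<^sup>2 * e" by (simp add: power2_eq_square power3_eq_cube)
      moreover have "22 * e\<^sup>2 * Suc j = 22 * e\<^sup>2 + 22 * (e\<^sup>2 * j)" by simp
      ultimately show "e + 22 * e\<^sup>2 * Suc j \<le> 45 * e ^ 3" by linarith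
    qed simp
    finally show ?thesis .
  qed
  ultimately show ?thesis using w by (intro exI[of _ u]) (auto simp: u_def e_def)
qed

section \<open>Instantiation and disjunction\<close>

lemma nat_len_le: "n < 2 ^ k \<Longrightarrow> 1 \<le> k \<Longrightarrow> nat_len n \<le> k"
  by (simp add: nat_len_def floorlog_leI)

lemma nat_len_mono: "m \<le> n \<Longrightarrow> nat_len m \<le> nat_len n"
  using floorlog_mono[of m n 2] by (auto simp: nat_len_def)

lemma int_len_le: "\<bar>z\<bar> < 2 ^ k \<Longrightarrow> 1 \<le> k \<Longrightarrow> int_len z \<le> k + 1"
  by (simp add: int_len_def nat_len_le nat_less_iff)

lemma exists_false_form:
  "\<exists>\<phi>. quantifier_free \<phi> \<and> free_vars \<phi> = {} \<and> (\<forall>v. \<not> sat v \<phi>) \<and> enc_len \<phi> = 3"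
  by (rule exI[of _ "Le [] (- 1)"])
    (simp add: lin_val_def lin_len_def int_len_def nat_len_def compute_floorlog)

lemma exists_const_form:
  "\<exists>\<phi>. quantifier_free \<phi> \<and> free_vars \<phi> = {} \<and> (\<forall>v. sat v \<phi> \<longleftrightarrow> P) \<and> enc_len \<phi> \<le> 4"
proof -
  obtain \<phi> where "quantifier_free \<phi>" "free_vars \<phi> = {}" "\<And>v. \<not> sat v \<phi>" "enc_len \<phi> = 3"
    using exists_false_form by blast
  then show ?thesis by (cases P) (intro exI[of _ "Neg \<phi>"] exI[of _ \<phi>]; simp)+
qed

text \<open>The grammar has no atom for \<open>a x\<close> congruent to \<open>c\<close>, which
  arises when one side of \<open>CongVars\<close> is instantiated. If it is solvable, division by
  the gcd of \<open>a\<close> and \<open>k\<close> makes the coefficient invertible, and the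
  solutions form a single residue class; otherwise a false formula serves.\<close>

lemma exists_lin_cong_form:
  assumes "0 < k"
  shows "\<exists>\<phi>. quantifier_free \<phi> \<and> free_vars \<phi> \<subseteq> {x} \<and>
    (\<forall>v. sat v \<phi> \<longleftrightarrow> int k dvd a * int (v x) - c) \<and> enc_len \<phi> \<le> 4 + 2 * nat_len k + nat_len x"
proof (cases "\<exists>n::nat. int k dvd a * int n - c")
  case False
  obtain \<phi> where "quantifier_free \<phi>" "free_vars \<phi> = {}" "\<And>v. \<not> sat v \<phi>" "enc_len \<phi> = 3"
    using exists_false_form by blast
  with False show ?thesis by (intro exI[of _ \<phi>]) auto
next
  case True
  then obtain n :: nat where n: "int k dvd a * int n - c" by blast
  define g where "g = gcd a (int k)"
  define a' where "a' = a div g"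
  define k' where "k' = nat (int k div g)"
  have g: "0 < g" using assms by (simp add: g_def)
  have k': "int k = g * int k'" "0 < k'"
  proof -
    have "0 < int k div g" using assms g by (simp add: g_def pos_imp_zdiv_pos_iff zdvd_imp_le)
    then show "int k = g * int k'" "0 < k'" by (simp_all add: k'_def g_def)
  qed
  have a': "a = g * a'" by (simp add: a'_def g_def)
  have "coprime a' (int k div g)"
    unfolding a'_def g_def using assms by (intro div_gcd_coprime) auto
  then have cop: "coprime (int k') a'" using k' g by (simp add: coprime_commute)
  have "k' \<le> k"
  proof -
    have "1 * int k' \<le> g * int k'" using g by (intro mult_right_mono) auto
    then show ?thesis using k'(1) by simp
  qed
  \<comment> \<open>Subtracting the solution \<open>n\<close> makes the congruence homogeneous; then
    \<open>g\<close> and the coprime factor \<open>a'\<close> cancel.\<close>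
  have iff: "int k dvd a * int m - c \<longleftrightarrow> int k' dvd int m - int (n mod k')" for m
  proof -
    have "int k dvd a * int m - c \<longleftrightarrow> int k dvd (a * int m - c) - (a * int n - c)"
      using n by (intro dvd_iff_if_dvd_diff) simp
    also have "(a * int m - c) - (a * int n - c) = g * (a' * (int m - int n))"
      by (simp add: a' algebra_simps)
    also have "int k dvd \<dots> \<longleftrightarrow> int k' dvd a' * (int m - int n)"
      using g by (simp add: k'(1))
    also have "\<dots> \<longleftrightarrow> int k' dvd int m - int n"
      using cop by (rule coprime_dvd_mult_right_iff)
    also have "\<dots> \<longleftrightarrow> int k' dvd int m - int (n mod k')"
    proof (rule dvd_iff_if_dvd_diff)
      have "int n = int (n mod k') + int k' * int (n div k')"
        by (metis mod_mult_div_eq of_nat_add of_nat_mult)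
      then have "(int m - int n) - (int m - int (n mod k')) = int k' * - int (n div k')" by simp
      then show "int k' dvd (int m - int n) - (int m - int (n mod k'))" by (simp only: dvd_triv_left)
    qed
    finally show ?thesis .
  qed
  have "nat_len k' \<le> nat_len k" "nat_len (n mod k') \<le> nat_len k"
    using \<open>k' \<le> k\<close> k'(2) by (auto intro!: nat_len_mono intro: order_trans[OF less_imp_le[OF mod_less_divisor]])
  then show ?thesis using k'(2) iff
    by (intro exI[of _ "CongConst k' x (n mod k')"]) auto
qed

section \<open>Instantiation of variables\<close>

lemma lin_len_proj_le: "lin_len (lin_proj V ts) \<le> lin_len ts"
proof (induction ts)
  case (Cons t ts)
  then show ?case by (cases t) (auto simp: lin_len_def lin_proj_def)
qed (simp add: lin_len_def lin_proj_def)

lemma lin_val_instantiate: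
  "lin_val (\<lambda>x. if x \<in> X then c x else v x) ts = lin_val c (lin_proj X ts) + lin_val v (lin_proj (- X) ts)"
  by (induction ts) (auto simp: lin_val_def lin_proj_def)

text \<open>The new constant has at most \<open>e + q + 1\<close> binary digits, where
  \<open>e\<close> is the length of the atom. The generous product form of the bound adds up over
  subformulas.\<close>

lemma instantiate_lin_len_le:
  assumes "\<And>x. x \<in> X \<Longrightarrow> c x \<le> 2 ^ q"
  shows "1 + lin_len (lin_proj (- X) ts) + int_len (b - lin_val c (lin_proj X ts))
    \<le> (1 + lin_len ts + int_len b) * (q + 6)"
proof -
  define e where "e = 1 + lin_len ts + int_len b"
  have "\<bar>lin_val c (lin_proj X ts)\<bar> \<le> lin_norm (lin_proj X ts) * int (2 ^ q)"
    using assms by (intro abs_lin_val_le) (auto simp: vars_lin_proj)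
  also have "\<dots> \<le> 2 ^ lin_len ts * 2 ^ q"
    using lin_norm_proj_le[of X ts] lin_norm_less[of ts] by (simp add: mult_right_mono)
  also have "\<dots> = 2 ^ (lin_len ts + q)" by (simp add: power_add)
  also have "\<dots> \<le> 2 ^ (e + q)" by (intro power_increasing) (auto simp: e_def)
  finally have 1: "\<bar>lin_val c (lin_proj X ts)\<bar> \<le> 2 ^ (e + q)" .
  have "\<bar>b\<bar> < 2 ^ int_len b" by (rule abs_less_two_power_int_len)
  also have "\<dots> \<le> 2 ^ (e + q)" by (intro power_increasing) (auto simp: e_def)
  finally have "\<bar>b - lin_val c (lin_proj X ts)\<bar> < 2 ^ (e + q + 1)" using 1 by simp
  then have "int_len (b - lin_val c (lin_proj X ts)) \<le> e + q + 2"
    using int_len_le[of _ "e + q + 1"] by simp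
  moreover have "1 + lin_len (lin_proj (- X) ts) \<le> e"
    using lin_len_proj_le[of "- X" ts] by (simp add: e_def)
  moreover have "2 * e + q + 2 \<le> e * (q + 6)"
  proof -
    have "1 * (q + 4) \<le> e * (q + 4)" by (intro mult_le_mono1) (simp add: e_def)
    then show ?thesis by (simp add: algebra_simps)
  qed
  ultimately show ?thesis unfolding e_def[symmetric] by linarith
qed

text \<open>Linear atoms absorb the instantiated monomials into their constant; an instantiated
  congruence becomes a constant formula or a congruence in a single variable.\<close>

lemma exists_instantiated_form:
  assumes "quantifier_free \<psi>" "\<And>x. x \<in> X \<Longrightarrow> c x \<le> 2 ^ q"
  shows "\<exists>\<phi>. quantifier_free \<phi> \<and> free_vars \<phi> \<subseteq> free_vars \<psi> - X \<and>
    (\<forall>v. sat v \<phi> \<longleftrightarrow> sat (\<lambda>x. if x \<in> X then c x else v x) \<psi>) \<and> enc_len \<phi> \<le> enc_len \<psi> * (q + 6)"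
  using assms(1)
proof (induction \<psi>)
  case (Le ts b)
  show ?case
    using instantiate_lin_len_le[of X c q ts b, OF assms(2)]
    by (intro exI[of _ "Le (lin_proj (- X) ts) (b - lin_val c (lin_proj X ts))"])
      (auto simp: lin_val_instantiate vars_lin_proj)
next
  case (Ge ts b)
  show ?case
    using instantiate_lin_len_le[of X c q ts b, OF assms(2)]
    by (intro exI[of _ "Ge (lin_proj (- X) ts) (b - lin_val c (lin_proj X ts))"])
      (auto simp: lin_val_instantiate vars_lin_proj)
next
  case (CongVars k a x b y)
  let ?e = "enc_len (CongVars k a x b y)"
  have k: "0 < k" using CongVars by simp
  have e: "4 + 2 * nat_len k + nat_len x \<le> ?e * (q + 6)" "4 + 2 * nat_len k + nat_len y \<le> ?e * (q + 6)"
    "?e \<le> ?e * (q + 6)" "4 \<le> ?e * (q + 6)" by (simp_all add: algebra_simps)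
  consider "x \<in> X" "y \<in> X" | "x \<notin> X" "y \<in> X" | "x \<in> X" "y \<notin> X" | "x \<notin> X" "y \<notin> X" by blast
  then show ?case
  proof cases
    case 1
    obtain \<phi> where "quantifier_free \<phi>" "free_vars \<phi> = {}" "enc_len \<phi> \<le> 4"
      "\<And>v. sat v \<phi> \<longleftrightarrow> int k dvd a * int (c x) - b * int (c y)"
      using exists_const_form by blast
    with 1 e show ?thesis by (intro exI[of _ \<phi>]) auto
  next
    case 2
    obtain \<phi> where "quantifier_free \<phi>" "free_vars \<phi> \<subseteq> {x}" "enc_len \<phi> \<le> 4 + 2 * nat_len k + nat_len x"
      "\<And>v. sat v \<phi> \<longleftrightarrow> int k dvd a * int (v x) - b * int (c y)"
      using exists_lin_cong_form[OF k] by metis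
    with 2 e show ?thesis by (intro exI[of _ \<phi>]) auto
  next
    case 3
    obtain \<phi> where \<phi>: "quantifier_free \<phi>" "free_vars \<phi> \<subseteq> {y}" "enc_len \<phi> \<le> 4 + 2 * nat_len k + nat_len y"
      "\<And>v. sat v \<phi> \<longleftrightarrow> int k dvd b * int (v y) - a * int (c x)"
      using exists_lin_cong_form[OF k] by metis
    have "sat v \<phi> \<longleftrightarrow> int k dvd a * int (c x) - b * int (v y)" for v
      unfolding \<phi>(4) by (rule dvd_diff_commute)
    with 3 e \<phi> show ?thesis by (intro exI[of _ \<phi>]) auto
  next
    case 4
    with k e show ?thesis by (intro exI[of _ "CongVars k a x b y"]) auto
  qed
next
  case (CongConst k x d)
  let ?e = "enc_len (CongConst k x d)"
  have e: "?e \<le> ?e * (q + 6)" "4 \<le> ?e * (q + 6)" by (simp_all add: algebra_simps)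
  show ?case
  proof (cases "x \<in> X")
    case True
    obtain \<phi> where "quantifier_free \<phi>" "free_vars \<phi> = {}" "enc_len \<phi> \<le> 4"
      "\<And>v. sat v \<phi> \<longleftrightarrow> int k dvd int (c x) - int d"
      using exists_const_form by blast
    with True e show ?thesis by (intro exI[of _ \<phi>]) auto
  next
    case False
    with CongConst e show ?thesis by (intro exI[of _ "CongConst k x d"]) auto
  qed
next
  case (Conj \<psi>\<^sub>1 \<psi>\<^sub>2)
  then obtain \<phi>\<^sub>1 \<phi>\<^sub>2 where
    "quantifier_free \<phi>\<^sub>1 \<and> free_vars \<phi>\<^sub>1 \<subseteq> free_vars \<psi>\<^sub>1 - X \<and>
      (\<forall>v. sat v \<phi>\<^sub>1 \<longleftrightarrow> sat (\<lambda>x. if x \<in> X then c x else v x) \<psi>\<^sub>1) \<and> enc_len \<phi>\<^sub>1 \<le> enc_len \<psi>\<^sub>1 * (q + 6)"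
    "quantifier_free \<phi>\<^sub>2 \<and> free_vars \<phi>\<^sub>2 \<subseteq> free_vars \<psi>\<^sub>2 - X \<and>
      (\<forall>v. sat v \<phi>\<^sub>2 \<longleftrightarrow> sat (\<lambda>x. if x \<in> X then c x else v x) \<psi>\<^sub>2) \<and> enc_len \<phi>\<^sub>2 \<le> enc_len \<psi>\<^sub>2 * (q + 6)"
    by auto
  then show ?case by (intro exI[of _ "Conj \<phi>\<^sub>1 \<phi>\<^sub>2"]) (auto simp: algebra_simps)
next
  case (Neg \<psi>)
  then obtain \<phi> where "quantifier_free \<phi> \<and> free_vars \<phi> \<subseteq> free_vars \<psi> - X \<and>
      (\<forall>v. sat v \<phi> \<longleftrightarrow> sat (\<lambda>x. if x \<in> X then c x else v x) \<psi>) \<and> enc_len \<phi> \<le> enc_len \<psi> * (q + 6)"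
    by auto
  then show ?case by (intro exI[of _ "Neg \<phi>"]) auto
qed auto

section \<open>Disjunctions, tuples of quantifiers and the final estimate\<close>

text \<open>Disjunction is expressed by De Morgan's law at the cost of four symbols per disjunct; a
  false formula of length 3 ends the chain.\<close>

lemma exists_disjunction:
  assumes "finite C" "\<And>c. c \<in> C \<Longrightarrow> quantifier_free (f c) \<and> free_vars (f c) \<subseteq> V \<and> enc_len (f c) \<le> l"
  shows "\<exists>\<phi>. quantifier_free \<phi> \<and> free_vars \<phi> \<subseteq> V \<and> (\<forall>v. sat v \<phi> \<longleftrightarrow> (\<exists>c\<in>C. sat v (f c))) \<and>
    enc_len \<phi> \<le> 3 + card C * (l + 4)"
  using assms
proof (induction C rule: finite_induct)
  case empty
  then show ?case using exists_false_form by fastforce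
next
  case (insert c C)
  then obtain \<phi> where \<phi>: "quantifier_free \<phi>" "free_vars \<phi> \<subseteq> V"
    "\<forall>v. sat v \<phi> \<longleftrightarrow> (\<exists>c\<in>C. sat v (f c))" "enc_len \<phi> \<le> 3 + card C * (l + 4)" by auto
  have "quantifier_free (f c) \<and> free_vars (f c) \<subseteq> V \<and> enc_len (f c) \<le> l" using insert.prems by simp
  then show ?case using \<phi> insert.hyps
    by (intro exI[of _ "Neg (Conj (Neg (f c)) (Neg \<phi>))"]) auto
qed

lemma sat_exists_tuple:
  "sat v (exists_tuple xs \<phi>) \<longleftrightarrow> (\<exists>u. (\<forall>x. x \<notin> set xs \<longrightarrow> u x = v x) \<and> sat u \<phi>)"
proof (induction xs arbitrary: v)
  case Nil
  have "u = v" if "\<forall>x. u x = v x" for u using that by auto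
  then show ?case by (auto simp: exists_tuple_def)
next
  case (Cons y xs)
  have "sat v (exists_tuple (y # xs) \<phi>)
      \<longleftrightarrow> (\<exists>n u. (\<forall>x. x \<notin> set xs \<longrightarrow> u x = (v(y := n)) x) \<and> sat u \<phi>)"
    using Cons by (simp add: exists_tuple_def)
  also have "\<dots> \<longleftrightarrow> (\<exists>u. (\<forall>x. x \<notin> set (y # xs) \<longrightarrow> u x = v x) \<and> sat u \<phi>)"
  proof
    assume "\<exists>u. (\<forall>x. x \<notin> set (y # xs) \<longrightarrow> u x = v x) \<and> sat u \<phi>"
    then obtain u where "\<forall>x. x \<notin> set (y # xs) \<longrightarrow> u x = v x" "sat u \<phi>" by blast
    then show "\<exists>n u. (\<forall>x. x \<notin> set xs \<longrightarrow> u x = (v(y := n)) x) \<and> sat u \<phi>"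
      by (intro exI[of _ "u y"] exI[of _ u]) auto
  qed (auto split: if_splits)
  finally show ?case .
qed

text \<open>Lets the number of candidate tuples and the size of each instance be measured by the
  size of the quantified formula.\<close>

lemma enc_len_exists_tuple: "length xs + enc_len \<phi> \<le> enc_len (exists_tuple xs \<phi>)"
  by (induction xs) (auto simp: exists_tuple_def)

theorem proposition5p2:
  "\<exists>p :: nat poly. \<forall>(\<psi> :: pform) (xs :: nat list) (ys :: nat list).
     distinct (xs @ ys) \<longrightarrow>
     quantifier_free \<psi> \<longrightarrow>
     free_vars \<psi> \<subseteq> set xs \<union> set ys \<longrightarrow>
     variadic_decomposable \<psi> xs ys \<longrightarrow>
     (\<exists>\<phi>'. quantifier_free \<phi>' \<and>
           free_vars \<phi>' \<subseteq> set ys \<and>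
           equivalent \<phi>' (exists_tuple xs \<psi>) \<and>
           enc_len \<phi>' \<le> 2 ^ poly p (enc_len (exists_tuple xs \<psi>)))"
\<comment> \<open>The final exponent is \<open>2 * (q * s) + 7 * s + 7\<close> with
  \<open>q * s \<le> 45 * s ^ 4\<close>, and 104 = 90 + 7 + 7.\<close>
proof (intro exI[of _ "monom 104 4"] allI impI)
  fix \<psi> xs ys
  assume dist: "distinct (xs @ ys)" and qf: "quantifier_free \<psi>"
    and vars: "free_vars \<psi> \<subseteq> set xs \<union> set ys" and dec: "variadic_decomposable \<psi> xs ys"
  define e where "e = enc_len \<psi>"
  define s where "s = enc_len (exists_tuple xs \<psi>)"
  define q where "q = 45 * e ^ 3"
  define X where "X = set xs"
  define C where "C = X \<rightarrow>\<^sub>E {..(2::nat) ^ q}"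
  have X: "finite X" "card X \<le> s" "e \<le> s"
    using enc_len_exists_tuple[of xs \<psi>] card_length[of xs] by (auto simp: X_def s_def e_def)
  obtain ds where ds: "\<forall>(\<Delta>, \<chi>) \<in> set ds. quantifier_free \<Delta> \<and> free_vars \<Delta> \<subseteq> X \<and>
      quantifier_free \<chi> \<and> free_vars \<chi> \<subseteq> set ys"
    "\<forall>v. sat v \<psi> \<longleftrightarrow> (\<exists>(\<Delta>, \<chi>) \<in> set ds. sat v \<Delta> \<and> sat v \<chi>)"
    using dec unfolding variadic_decomposable_def X_def by blast
  have "\<exists>\<phi>. quantifier_free \<phi> \<and> free_vars \<phi> \<subseteq> free_vars \<psi> - X \<and>
    (\<forall>v. sat v \<phi> \<longleftrightarrow> sat (\<lambda>x. if x \<in> X then c x else v x) \<psi>) \<and> enc_len \<phi> \<le> e * (q + 6)" if "c \<in> C" for c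
    unfolding e_def using that by (intro exists_instantiated_form[OF qf]) (auto simp: C_def)
  then obtain f where f: "\<And>c. c \<in> C \<Longrightarrow> quantifier_free (f c) \<and> free_vars (f c) \<subseteq> free_vars \<psi> - X \<and>
    (\<forall>v. sat v (f c) \<longleftrightarrow> sat (\<lambda>x. if x \<in> X then c x else v x) \<psi>) \<and> enc_len (f c) \<le> e * (q + 6)" by metis
  have "finite C" using X by (auto simp: C_def intro: finite_PiE)
  moreover have "quantifier_free (f c) \<and> free_vars (f c) \<subseteq> set ys \<and> enc_len (f c) \<le> e * (q + 6)"
    if "c \<in> C" for c
    using f[OF that] vars by (auto simp: X_def)
  ultimately obtain \<phi> where \<phi>: "quantifier_free \<phi>" "free_vars \<phi> \<subseteq> set ys"
    "\<And>v. sat v \<phi> \<longleftrightarrow> (\<exists>c\<in>C. sat v (f c))" "enc_len \<phi> \<le> 3 + card C * (e * (q + 6) + 4)"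
    using exists_disjunction[of C f "set ys" "e * (q + 6)"] by blast
  have "sat v \<phi> \<longleftrightarrow> sat v (exists_tuple xs \<psi>)" for v
  proof
    assume "sat v \<phi>"
    then obtain c where "sat (\<lambda>x. if x \<in> X then c x else v x) \<psi>" using \<phi>(3) f by blast
    then show "sat v (exists_tuple xs \<psi>)"
      unfolding sat_exists_tuple by (intro exI[of _ "\<lambda>x. if x \<in> X then c x else v x"]) (simp add: X_def)
  next
    assume "sat v (exists_tuple xs \<psi>)"
    then obtain w where w: "\<And>x. x \<notin> X \<Longrightarrow> w x = v x" "sat w \<psi>"
      unfolding sat_exists_tuple X_def by blast
    have "X \<inter> set ys = {}" "free_vars \<psi> \<subseteq> X \<union> set ys" using dist vars by (auto simp: X_def)
    from exists_small_witness[OF qf this ds w(2)] obtain u where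
      u: "sat u \<psi>" "\<And>x. x \<notin> X \<Longrightarrow> u x = w x" "\<And>x. x \<in> X \<Longrightarrow> u x \<le> 2 ^ q"
      unfolding q_def e_def by blast
    define c where "c = restrict u X"
    have "c \<in> C" using u(3) by (auto simp: c_def C_def)
    moreover have "(\<lambda>x. if x \<in> X then c x else v x) = u" using u(2) w(1) by (auto simp: c_def)
    then have "sat v (f c)" using f[OF \<open>c \<in> C\<close>] u(1) by simp
    ultimately show "sat v \<phi>" using \<phi>(3) by blast
  qed
  then have "equivalent \<phi> (exists_tuple xs \<psi>)" by (simp add: equivalent_def)
  moreover have "enc_len \<phi> \<le> 2 ^ poly (monom 104 4) s"
  proof -
    have "card C = (2 ^ q + 1) ^ card X" using X by (simp add: C_def card_funcsetE)
    also have "\<dots> \<le> (2 ^ (q + 1)) ^ card X" by (intro power_mono) simp_all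
    also have "\<dots> = 2 ^ ((q + 1) * card X)" by (simp only: power_mult)
    also have "\<dots> \<le> 2 ^ ((q + 1) * s)" using X by (intro power_increasing mult_le_mono) auto
    finally have C: "card C \<le> 2 ^ ((q + 1) * s)" .
    have "enc_len \<phi> \<le> 3 + card C * (e * (q + 6) + 4)" by (rule \<phi>(4))
    also have "\<dots> \<le> 3 * 2 ^ ((q + 1) * s) + 2 ^ ((q + 1) * s) * (s * (q + 6) + 4)"
      using C X by (intro add_mono mult_le_mono) auto
    also have "\<dots> = 2 ^ ((q + 1) * s) * (s * (q + 6) + 7)" by (simp add: algebra_simps)
    \<comment> \<open>The second factor is absorbed by \<open>k < 2 ^ k\<close>, which merely adds
      it to the exponent.\<close>
    also have "\<dots> \<le> 2 ^ ((q + 1) * s) * 2 ^ (s * (q + 6) + 7)"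
      by (intro mult_le_mono order_refl less_imp_le less_exp)
    also have "\<dots> = 2 ^ ((q + 1) * s + (s * (q + 6) + 7))" by (simp only: power_add)
    also have "\<dots> \<le> 2 ^ (104 * s ^ 4)"
    proof (rule power_increasing)
      have "1 \<le> s" using enc_len_pos[of "exists_tuple xs \<psi>"] by (simp add: s_def)
      then have "s * 1 \<le> s * s ^ 3" "1 \<le> s ^ 4" by (auto intro: mult_le_mono)
      moreover have "q * s \<le> 45 * s ^ 3 * s"
        unfolding q_def using X by (intro mult_le_mono power_mono) auto
      moreover have "s * s ^ 3 = s ^ 4" "s ^ 3 * s = s ^ 4"
        by (simp_all add: power3_eq_cube power4_eq_xxxx)
      moreover have "(q + 1) * s + (s * (q + 6) + 7) = 2 * (q * s) + 7 * s + 7"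
        by (simp add: algebra_simps)
      ultimately show "(q + 1) * s + (s * (q + 6) + 7) \<le> 104 * s ^ 4" by linarith
    qed simp
    finally show ?thesis by (simp add: poly_monom)
  qed
  ultimately show "\<exists>\<phi>'. quantifier_free \<phi>' \<and> free_vars \<phi>' \<subseteq> set ys \<and>
      equivalent \<phi>' (exists_tuple xs \<psi>) \<and>
      enc_len \<phi>' \<le> 2 ^ poly (monom 104 4) (enc_len (exists_tuple xs \<psi>))"
    using \<phi> unfolding s_def by blast
qed

end
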